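(* Let $\mathbf{X}$ be a computably compact Hausdorff represented space admitting a proper computable dyadic subbase. Then there are a computable strictly increasing $f:\mathbb{N}\to\mathbb{N}$ and computable maps $R:\{0,1\}^{f( * )}\to\mathcal{O}(\mathbf{X})$, $\overline{R}:\{0,1\}^{f( * )}\to\mathcal{A}(\mathbf{X})$ such that: (1) $R(\varepsilon)=X$; (2) for $w\in\{0,1\}^{f(n)}$, $R(w)=\bigcup_{v\in\{0,1\}^{f(n+1)},\, w\sqsubseteq v}R(v)$; (3) $\mathrm{cl}\,R(w)=\overline{R}(w)$ for all $w$; (4) $(R(w))_{w\in\{0,1\}^{f( * )}}$ is an effective countable basis of $\mathbf{X}$; (5) there is a computable $I:\{0,1\}^{f( * )}\times\{0,1\}^{f( * )}\to\{\emptyset\}\uplus\{0,1\}^{f( * )}$ such that if $I(w,v)=\emptyset$ then $R(w)\cap R(v)=\emptyset$, and otherwise $w\sqsubseteq I(w,v)$ and $R(w)\cap R(v)=R(I(w,v))$; (6) there is a computable $E:\{0,1\}^{f( * )}\times\{0,1\}^{f( * )}\to\{0,1\}$ such that $E(w,v)=1\Rightarrow R(w)=R(v)$; (7) for all $x\neq y$ in $\mathbf{X}$ there is $n\in\mathbb{N}$ such that for all $w,v\in\{0,1\}^{f(n)}$: if $x,y\in\overline{R}(w)$ and $x,y\in\overline{R}(v)$ then $E(w,v)=1$.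
   Context: For strictly increasing $f:\mathbb{N}\to\mathbb{N}$, $\{0,1\}^{f( * )}:=\bigcup_{n\in\mathbb{N}}\{0,1\}^{f(n)}$ (finite binary words of the lengths $f(n)$, represented as finite words); $\sqsubseteq$ is the prefix relation and $\varepsilon$ the empty word (note this presupposes $f(0)=0$ as used by the paper). A represented space is a pair $\mathbf{X}=(X,\delta_X)$ with $\delta_X :\subseteq \{0,1\}^\omega \to X$ a partial surjection; a map is computable if it has a computable realizer on names. Sierpiński space $\mathbb{S}=\{\bot,\top\}$ has $\delta_\mathbb{S}(0^\omega)=\bot$, $\delta_\mathbb{S}(p)=\top$ otherwise. $\mathcal{O}(\mathbf{X})$: open sets $U$ represented via $\chi_U\in\mathcal{C}(\mathbf{X},\mathbb{S})$ (standard function-space representation); the topology of $\mathbf{X}$ is the final topology of $\delta_X$, and "Hausdorff" refers to it. $\mathcal{A}(\mathbf{X})$: closed sets represented by $\mathcal{O}(\mathbf{X})$-names of their complements. $\mathbf{X}$ is computably compact if $\mathrm{isEmpty}:\mathcal{A}(\mathbf{X})\to\mathbb{S}$ is computable. A countable family $(B_i)_{i}$ of open sets is an effective countable basis if it is a basis of the topology, $i\mapsto B_i$ is computable into $\mathcal{O}(\mathbf{X})$, and from $U\in\mathcal{O}(\mathbf{X})$ one can compute an enumeration of a set $J$ of indices with $U=\bigcup_{i\in J}B_i$. Plotkin's $\mathbb{T}=\{0,1,\bot\}$ is represented by $\delta_\mathbb{T}(0^\omega)=\bot$, $\delta_\mathbb{T}(p)=0$ if $\min\{n\mid p(n)=1\}$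 is even and $1$ if odd; $\mathbb{T}^\omega$ carries the induced product representation. A dyadic subbase of $\mathbf{X}$ is a map $S:\mathbb{N}\times\{0,1\}\to\mathcal{O}(\mathbf{X})$, $(n,i)\mapsto S_{n,i}$, whose image is a subbase of the topology and with $S_{n,0}\cap S_{n,1}=\emptyset$. Let $S_{n,\bot}=X\setminus(S_{n,0}\cup S_{n,1})$ and $\varphi_S:X\to\mathbb{T}^\omega$, $\varphi_S(x)(n)=a$ iff $x\in S_{n,a}$. $S$ is computable if $S$ is computable and $\varphi_S$ and its partial inverse are computable. For $p\in\mathbb{T}^\omega$ let $\operatorname{dom}(p)=\{k\mid p(k)\neq\bot\}$, $S(p)=\bigcap_{k\in\operatorname{dom}(p)}S_{k,p(k)}$, $\bar S(p)=\bigcap_{k\in\operatorname{dom}(p)}(X\setminus S_{k,1-p(k)})$; finite sequences $e$ over $\mathbb{T}$ are identified with $e\bot^\omega$. $S$ is proper if $\mathrm{cl}\,S(e)=\bar S(e)$ for all finite sequences $e$ over $\mathbb{T}$. *)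

theory Defs
  imports "HOL-Analysis.Analysis" "HOL-Library.Sublist" "HOL-Library.Nat_Bijection"
begin

section \<open>Computability on Cantor space\<close>

type_synonym cantor = "nat \<Rightarrow> bool"

text \<open>
  Partial recursive functionals with a Cantor-space oracle: the least class of partial functions
  \<open>\<nat> \<rightharpoonup> \<nat>\<close>, uniform in the oracle \<open>p\<close>, that contains the oracle and the basic functions and is closed
  under pairing, composition, primitive recursion and unbounded search. Several arguments are
  passed through the Cantor pairing function \<open>prod_encode\<close>, so all functions can be unary.
\<close>

inductive recursive_functional :: "(cantor \<Rightarrow> nat \<Rightarrow> nat option) \<Rightarrow> bool" where
  rf_oracle: "recursive_functional (\<lambda>p n. Some (of_bool (p n)))"
| rf_zero: "recursive_functional (\<lambda>p n. Some 0)"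
| rf_succ: "recursive_functional (\<lambda>p n. Some (Suc n))"
| rf_left: "recursive_functional (\<lambda>p n. Some (fst (prod_decode n)))"
| rf_right: "recursive_functional (\<lambda>p n. Some (snd (prod_decode n)))"
| rf_pair: "recursive_functional F \<Longrightarrow> recursive_functional G \<Longrightarrow>
    recursive_functional (\<lambda>p n. Option.bind (F p n) (\<lambda>a. Option.bind (G p n) (\<lambda>b.
      Some (prod_encode (a, b)))))"
| rf_comp: "recursive_functional F \<Longrightarrow> recursive_functional G \<Longrightarrow>
    recursive_functional (\<lambda>p n. Option.bind (G p n) (F p))"
| rf_prec: "recursive_functional F \<Longrightarrow> recursive_functional G \<Longrightarrow>
    recursive_functional (\<lambda>p n. case prod_decode n of (a, m) \<Rightarrow>
      rec_nat (F p a)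
        (\<lambda>k r. Option.bind r (\<lambda>i. G p (prod_encode (a, prod_encode (k, i))))) m)"
| rf_mu: "recursive_functional F \<Longrightarrow>
    recursive_functional (\<lambda>p a.
      if \<exists>n. F p (prod_encode (a, n)) = Some 0 \<and>
             (\<forall>m<n. \<exists>v. F p (prod_encode (a, m)) = Some (Suc v))
      then Some (LEAST n. F p (prod_encode (a, n)) = Some 0)
      else None)"

text \<open>\<open>F\<close> computes the point \<open>q\<close> of Cantor space, bit by bit, from the oracle \<open>p\<close>.\<close>

definition computes_from ::
  "(cantor \<Rightarrow> nat \<Rightarrow> nat option) \<Rightarrow> cantor \<Rightarrow> cantor \<Rightarrow> bool" where
  "computes_from F p q \<longleftrightarrow> (\<forall>n. F p n = Some (of_bool (q n)))"


section \<open>Represented spaces and computable maps\<close>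

text \<open>
  A represented space is given by its representation, a partial function on Cantor space; the
  underlying set is \<open>ran \<delta>\<close>, so surjectivity is built in.
\<close>

type_synonym 'a repspace = "cantor \<Rightarrow> 'a option"

abbreviation points :: "'a repspace \<Rightarrow> 'a set" where
  "points \<delta> \<equiv> ran \<delta>"

text \<open>
  A partial multivalued map is given by its set of admissible values at each point; its domain
  consists of the points where this set is nonempty.
\<close>

definition computable_mv :: "'a repspace \<Rightarrow> 'b repspace \<Rightarrow> ('a \<Rightarrow> 'b set) \<Rightarrow> bool" where
  "computable_mv X Y M \<longleftrightarrow> (\<exists>F. recursive_functional F \<and>
     (\<forall>p x. X p = Some x \<and> M x \<noteq> {} \<longrightarrow>
       (\<exists>q y. computes_from F p q \<and> Y q = Some y \<and> y \<in> M x)))"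

definition computable_map :: "'a repspace \<Rightarrow> 'b repspace \<Rightarrow> ('a \<Rightarrow> 'b) \<Rightarrow> bool" where
  "computable_map X Y f \<longleftrightarrow> computable_mv X Y (\<lambda>x. {f x})"

definition nat_rep :: "nat repspace" where
  "nat_rep p = (if \<exists>n. p n then Some (LEAST n. p n) else None)"

definition bool_rep :: "bool repspace" where
  "bool_rep p = Some (p 0)"

text \<open>
  Bijective base-2 numbering of the finite binary words: the binary expansion of
  \<open>word_code w + 1\<close> is a leading \<open>1\<close> followed by the reversal of \<open>w\<close>.
\<close>

primrec word_code :: "bool list \<Rightarrow> nat" where
  "word_code [] = 0"
| "word_code (b # w) = 2 * word_code w + (if b then 2 else 1)"

lemma bij_word_code: "bij word_code"
proof (rule bijI)
  show "inj word_code"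
  proof (rule injI)
    fix v w show "word_code v = word_code w \<Longrightarrow> v = w"
    proof (induction v arbitrary: w)
      case Nil
      then show ?case by (cases w) (auto split: if_splits)
    next
      case (Cons b v)
      then show ?case
      proof (cases w)
        case Nil
        with Cons.prems show ?thesis by (auto split: if_splits)
      next
        case (Cons c w')
        with Cons.prems have "b = c \<and> word_code v = word_code w'"
          by (simp split: if_splits) presburger+
        with Cons.IH Cons show ?thesis by simp
      qed
    qed
  qed
  show "surj word_code"
  proof -
    have "\<exists>w. n = word_code w" for n
    proof (induction n rule: less_induct)
      case (less n)
      show ?case
      proof (cases "n = 0")
        case True
        then show ?thesis by (metis word_code.simps(1))
      next
        case False
        then have "(n - 1) div 2 < n" by auto
        then obtain w where w: "(n - 1) div 2 = word_code w" using less by blast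
        from False have "n = word_code (even n # w)"
          unfolding word_code.simps w[symmetric] by (auto elim!: evenE oddE)
        then show ?thesis by blast
      qed
    qed
    then show ?thesis by (auto simp: surj_def)
  qed
qed

definition word_rep :: "bool list repspace" where
  "word_rep p = map_option (inv word_code) (nat_rep p)"

definition sub_rep :: "'a repspace \<Rightarrow> 'a set \<Rightarrow> 'a repspace" where
  "sub_rep X A p = Option.bind (X p) (\<lambda>x. if x \<in> A then Some x else None)"

definition prod_rep :: "'a repspace \<Rightarrow> 'b repspace \<Rightarrow> ('a \<times> 'b) repspace" where
  "prod_rep X Y p =
     Option.bind (X (\<lambda>n. p (2 * n))) (\<lambda>x. Option.bind (Y (\<lambda>n. p (2 * n + 1))) (\<lambda>y. Some (x, y)))"

text \<open>The disjoint union of a one-point space \<open>{None}\<close> and \<open>X\<close>.\<close>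

definition option_rep :: "'a repspace \<Rightarrow> 'a option repspace" where
  "option_rep X p = (if p 0 then map_option Some (X (\<lambda>n. p (Suc n))) else Some None)"

definition seq_rep :: "'a repspace \<Rightarrow> (nat \<Rightarrow> 'a) repspace" where
  "seq_rep X p =
     (if \<forall>n. X (\<lambda>k. p (prod_encode (n, k))) \<noteq> None
      then Some (\<lambda>n. the (X (\<lambda>k. p (prod_encode (n, k))))) else None)"

text \<open>Sierpinski space, with \<open>True\<close> as the top element.\<close>

definition sierp_rep :: "bool repspace" where
  "sierp_rep p = Some (\<exists>n. p n)"


section \<open>Function spaces, open and closed sets\<close>

definition initial_segment :: "cantor \<Rightarrow> nat \<Rightarrow> bool list" where
  "initial_segment q k = map q [0..<k]"

text \<open>
  Application in Kleene's second algebra over Cantor space: \<open>p\<close> is an associate. For growing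
  prefixes \<open>u\<close> of the input \<open>q\<close> it is asked for the \<open>n\<close>-th output bit; \<open>p\<close> at the even position
  belonging to \<open>(u, n)\<close> tells whether \<open>u\<close> suffices to answer, and if so the next (odd) position
  holds the answer.
\<close>

definition associate_app :: "cantor \<Rightarrow> cantor \<Rightarrow> cantor \<Rightarrow> bool" where
  "associate_app p q r \<longleftrightarrow>
     (\<forall>n. \<exists>k. let c = (\<lambda>j. 2 * prod_encode (word_code (initial_segment q j), n)) in
        p (c k) \<and> (\<forall>j<k. \<not> p (c j)) \<and> r n = p (c k + 1))"

definition fun_name :: "'a repspace \<Rightarrow> 'b repspace \<Rightarrow> cantor \<Rightarrow> ('a \<Rightarrow> 'b) \<Rightarrow> bool" where
  "fun_name X Y p f \<longleftrightarrow> f \<in> extensional (points X) \<and>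
     (\<forall>q x. X q = Some x \<longrightarrow> (\<exists>r. associate_app p q r \<and> Y r = Some (f x)))"

definition fun_rep :: "'a repspace \<Rightarrow> 'b repspace \<Rightarrow> ('a \<Rightarrow> 'b) repspace" where
  "fun_rep X Y p = (if \<exists>f. fun_name X Y p f then Some (THE f. fun_name X Y p f) else None)"

lemma associate_app_unique:
  assumes "associate_app p q r" "associate_app p q r'"
  shows "r = r'"
proof
  fix n
  obtain k where k: "p (2 * prod_encode (word_code (initial_segment q k), n))"
      "\<forall>j<k. \<not> p (2 * prod_encode (word_code (initial_segment q j), n))"
      "r n = p (2 * prod_encode (word_code (initial_segment q k), n) + 1)"
    using assms(1)[unfolded associate_app_def Let_def, rule_format, of n] by blast
  obtain k' where k': "p (2 * prod_encode (word_code (initial_segment q k'), n))"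
      "\<forall>j<k'. \<not> p (2 * prod_encode (word_code (initial_segment q j), n))"
      "r' n = p (2 * prod_encode (word_code (initial_segment q k'), n) + 1)"
    using assms(2)[unfolded associate_app_def Let_def, rule_format, of n] by blast
  have "k = k'"
  proof (cases k k' rule: linorder_cases)
    case less
    with k(1) k'(2) show ?thesis by blast
  next
    case greater
    with k(2) k'(1) show ?thesis by blast
  qed
  then show "r n = r' n" using k k' by simp
qed

lemma fun_name_unique:
  assumes f: "fun_name X Y p f" and g: "fun_name X Y p g"
  shows "f = g"
proof (rule extensionalityI)
  show "f \<in> extensional (points X)" "g \<in> extensional (points X)"
    using f g by (auto simp: fun_name_def)
  fix x assume "x \<in> points X"
  then obtain q where q: "X q = Some x" by (auto simp: ran_def)
  obtain r where r: "associate_app p q r" "Y r = Some (f x)"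
    using f q by (auto simp: fun_name_def)
  obtain r' where r': "associate_app p q r'" "Y r' = Some (g x)"
    using g q by (auto simp: fun_name_def)
  have "r = r'" by (rule associate_app_unique[OF r(1) r'(1)])
  with r r' show "f x = g x" by simp
qed

lemma fun_rep_eq_Some_iff: "fun_rep X Y p = Some f \<longleftrightarrow> fun_name X Y p f"
proof -
  have "(THE f. fun_name X Y p f) = g" if "fun_name X Y p g" for g
    by (rule the_equality[where P = "fun_name X Y p", OF that]) (rule fun_name_unique[OF _ that])
  then show ?thesis by (auto simp: fun_rep_def)
qed

definition open_rep :: "'a repspace \<Rightarrow> 'a set repspace" where
  "open_rep X p = map_option (\<lambda>h. {x \<in> points X. h x}) (fun_rep X sierp_rep p)"

definition closed_rep :: "'a repspace \<Rightarrow> 'a set repspace" where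
  "closed_rep X p = map_option (\<lambda>U. points X - U) (open_rep X p)"


section \<open>Topology of a represented space\<close>

definition cantor_topology :: "cantor topology" where
  "cantor_topology = product_topology (\<lambda>_. discrete_topology UNIV) UNIV"

text \<open>The final topology of the representation.\<close>

definition rep_topology :: "'a repspace \<Rightarrow> 'a topology" where
  "rep_topology X = topology (\<lambda>U. U \<subseteq> points X \<and>
     openin (subtopology cantor_topology (dom X)) {p \<in> dom X. the (X p) \<in> U})"

lemma openin_rep_topology:
  "openin (rep_topology X) U \<longleftrightarrow> U \<subseteq> points X \<and>
     openin (subtopology cantor_topology (dom X)) {p \<in> dom X. the (X p) \<in> U}"
proof -
  let ?T = "subtopology cantor_topology (dom X)"
  let ?V = "\<lambda>U. {p \<in> dom X. the (X p) \<in> U}"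
  have "istopology (\<lambda>U. U \<subseteq> points X \<and> openin ?T (?V U))"
    unfolding istopology_def
  proof (intro conjI allI impI)
    fix S U assume *: "S \<subseteq> points X \<and> openin ?T (?V S)" "U \<subseteq> points X \<and> openin ?T (?V U)"
    then show "S \<inter> U \<subseteq> points X" by blast
    have "?V (S \<inter> U) = ?V S \<inter> ?V U" by blast
    then show "openin ?T (?V (S \<inter> U))" using * by (simp only: openin_Int)
  next
    fix K assume *: "\<forall>S\<in>K. S \<subseteq> points X \<and> openin ?T (?V S)"
    then show "\<Union>K \<subseteq> points X" by blast
    have "?V (\<Union>K) = (\<Union>S\<in>K. ?V S)" by blast
    moreover have "openin ?T (\<Union>S\<in>K. ?V S)" using * by (intro openin_Union) blast
    ultimately show "openin ?T (?V (\<Union>K))" by simp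
  qed
  then show ?thesis unfolding rep_topology_def by simp
qed

lemma topspace_rep_topology: "topspace (rep_topology X) = points X"
proof -
  have "{p \<in> dom X. the (X p) \<in> points X} = topspace (subtopology cantor_topology (dom X))"
    by (auto simp: cantor_topology_def intro: ranI)
  then have "openin (rep_topology X) (points X)"
    unfolding openin_rep_topology by (simp only: openin_topspace order_refl simp_thms)
  then have "points X \<subseteq> topspace (rep_topology X)" by (rule openin_subset)
  moreover have "topspace (rep_topology X) \<subseteq> points X"
    using openin_topspace[of "rep_topology X"] unfolding openin_rep_topology by (rule conjunct1)
  ultimately show ?thesis by (rule subset_antisym[rotated])
qed

definition computably_compact :: "'a repspace \<Rightarrow> bool" where
  "computably_compact X \<longleftrightarrow> computable_map (closed_rep X) sierp_rep (\<lambda>A. A = {})"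

text \<open>
  \<open>Ix\<close> is the represented space of indices. An enumeration of a set of indices is a sequence in
  which \<open>None\<close> means that nothing is listed, so that the empty set can be enumerated.
\<close>

definition effective_countable_basis ::
  "'i repspace \<Rightarrow> 'a repspace \<Rightarrow> ('i \<Rightarrow> 'a set) \<Rightarrow> bool" where
  "effective_countable_basis Ix X B \<longleftrightarrow>
     countable (points Ix) \<and>
     (\<forall>i \<in> points Ix. openin (rep_topology X) (B i)) \<and>
     (\<forall>U. openin (rep_topology X) U \<longrightarrow> (\<exists>J \<subseteq> points Ix. U = (\<Union>i\<in>J. B i))) \<and>
     computable_map Ix (open_rep X) B \<and>
     computable_mv (open_rep X) (seq_rep (option_rep Ix))
       (\<lambda>U. {s. U = (\<Union>i \<in> {i. Some i \<in> range s}. B i)})"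


section \<open>Dyadic subbases\<close>

text \<open>Plotkin's \<open>\<bbbT>\<close>, with \<open>None\<close> as the bottom element, \<open>Some False\<close> as 0 and \<open>Some True\<close> as 1.\<close>

definition plotkin_rep :: "bool option repspace" where
  "plotkin_rep p = Some (if \<exists>n. p n then Some (odd (LEAST n. p n)) else None)"

text \<open>
  The whole space is added to the generating family because a subbase need not cover the space:
  the empty intersection counts among the finite intersections.
\<close>

definition dyadic_subbase :: "'a repspace \<Rightarrow> (nat \<times> bool \<Rightarrow> 'a set) \<Rightarrow> bool" where
  "dyadic_subbase X S \<longleftrightarrow>
     range S \<subseteq> points (open_rep X) \<and>
     rep_topology X = topology_generated_by (insert (points X) (range S)) \<and>
     (\<forall>n. S (n, False) \<inter> S (n, True) = {})"

fun subbase_ext ::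
  "'a repspace \<Rightarrow> (nat \<times> bool \<Rightarrow> 'a set) \<Rightarrow> nat \<Rightarrow> bool option \<Rightarrow> 'a set" where
  "subbase_ext X S n (Some i) = S (n, i)"
| "subbase_ext X S n None = points X - (S (n, False) \<union> S (n, True))"

definition subbase_code ::
  "'a repspace \<Rightarrow> (nat \<times> bool \<Rightarrow> 'a set) \<Rightarrow> 'a \<Rightarrow> (nat \<Rightarrow> bool option)" where
  "subbase_code X S x n = (THE a. x \<in> subbase_ext X S n a)"

text \<open>
  The last conjunct is computability of the partial inverse of \<open>subbase_code X S\<close>, which is
  single-valued whenever \<open>X\<close> is \<open>T\<^sub>0\<close>.
\<close>

definition computable_dyadic_subbase :: "'a repspace \<Rightarrow> (nat \<times> bool \<Rightarrow> 'a set) \<Rightarrow> bool" where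
  "computable_dyadic_subbase X S \<longleftrightarrow>
     dyadic_subbase X S \<and>
     computable_map (prod_rep nat_rep bool_rep) (open_rep X) S \<and>
     computable_map X (seq_rep plotkin_rep) (subbase_code X S) \<and>
     computable_mv (seq_rep plotkin_rep) X (\<lambda>t. {x \<in> points X. subbase_code X S x = t})"

definition subbase_open ::
  "'a repspace \<Rightarrow> (nat \<times> bool \<Rightarrow> 'a set) \<Rightarrow> (nat \<Rightarrow> bool option) \<Rightarrow> 'a set" where
  "subbase_open X S p = {x \<in> points X. \<forall>k \<in> dom p. x \<in> S (k, the (p k))}"

definition subbase_closed ::
  "'a repspace \<Rightarrow> (nat \<times> bool \<Rightarrow> 'a set) \<Rightarrow> (nat \<Rightarrow> bool option) \<Rightarrow> 'a set" where
  "subbase_closed X S p = {x \<in> points X. \<forall>k \<in> dom p. x \<in> points X - S (k, \<not> the (p k))}"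

definition pad_bot :: "bool option list \<Rightarrow> (nat \<Rightarrow> bool option)" where
  "pad_bot e n = (if n < length e then e ! n else None)"

definition proper_subbase :: "'a repspace \<Rightarrow> (nat \<times> bool \<Rightarrow> 'a set) \<Rightarrow> bool" where
  "proper_subbase X S \<longleftrightarrow>
     (\<forall>e. rep_topology X closure_of subbase_open X S (pad_bot e) = subbase_closed X S (pad_bot e))"


section \<open>Words of prescribed lengths\<close>

definition words_of_length :: "nat \<Rightarrow> bool list set" where
  "words_of_length n = {w. length w = n}"

definition words :: "(nat \<Rightarrow> nat) \<Rightarrow> bool list set" where
  "words f = (\<Union>n. words_of_length (f n))"

definition words_rep :: "(nat \<Rightarrow> nat) \<Rightarrow> bool list repspace" where
  "words_rep f = sub_rep word_rep (words f)"

end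

theory Submission
  imports Defs
begin

text \<open>
  A letter is a finite conjunction of subbase sets. By computable compactness the finite
  covers of \<open>X\<close> by letters can be enumerated, so one can compute numbers
  \<open>0 = cut 0 < cut 1 < \<dots>\<close> such that the letters between \<open>cut n\<close> and \<open>cut (n + 1)\<close> which refine every
  cover enumerated before stage \<open>n\<close> still cover \<open>X\<close>. A word of level \<open>n\<close> encodes \<open>n\<close> distinct such
  letters, and \<open>R\<close> maps it to their intersection. Distinctness is the point: a later level can still
  add any given letter, so the intersection of two sets \<open>R w\<close>, \<open>R v\<close> occurs above \<open>w\<close>; but as
  there are only finitely many letters below \<open>cut t\<close>, all words of high level contain a letter that
  refines any given cover. Hence no \<open>R' w\<close> of high level contains two given points, and \<open>E\<close> can
  be constantly false. Properness gives the closures, and regularity of \<open>X\<close> the basis.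
\<close>

section \<open>Total recursive functions\<close>

text \<open>The difficulty is that inclusion, disjointness and equality of the open sets involved
  need not be decidable, while words, lengths and intersections have to be computed. Every decision
  is therefore made on syntax: refinement is inclusion of literal sets, an intersection is a union
  of letter sets, and a set \<open>R w\<close> is declared empty only when \<open>w\<close> fails a
  decidable validity test. The one semantic fact that enters, that finitely many letters cover the
  space, is semidecidable; it becomes decidable once it is paired with the output position at which
  the realizer of compactness reports it. To run that realizer on computed names, the oracle of a
  functional is replaced by a computed one. The same realizer gives ordinary compactness, because
  its answer depends on a finite part of the name; this makes the search for the next cut end and,
  with the Hausdorff property, makes the space regular.\<close>

named_theorems rec_intros

text \<open>Totality removes \<open>Option.bind\<close> from the closure rules. Binary functions
  occur as functions of \<open>pfst x\<close> and \<open>psnd x\<close>, so that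
  \<open>intro rec_intros\<close> can follow the syntax of a definition.\<close>

definition recf :: "(cantor \<Rightarrow> nat \<Rightarrow> nat) \<Rightarrow> bool" where
  "recf g \<longleftrightarrow> recursive_functional (\<lambda>p n. Some (g p n))"

definition recp :: "(cantor \<Rightarrow> nat \<Rightarrow> bool) \<Rightarrow> bool" where
  "recp P \<longleftrightarrow> recf (\<lambda>p n. of_bool (P p n))"

abbreviation pfst :: "nat \<Rightarrow> nat" where "pfst n \<equiv> fst (prod_decode n)"
abbreviation psnd :: "nat \<Rightarrow> nat" where "psnd n \<equiv> snd (prod_decode n)"

lemma recf_comp: "recf f \<Longrightarrow> recf g \<Longrightarrow> recf (\<lambda>p n. f p (g p n))"
  unfolding recf_def by (drule (1) rf_comp) simp

lemma recp_comp: "recp P \<Longrightarrow> recf g \<Longrightarrow> recp (\<lambda>p n. P p (g p n))"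
  unfolding recp_def by (rule recf_comp)

lemma recf_pfst [rec_intros]: "recf a \<Longrightarrow> recf (\<lambda>p n. pfst (a p n))"
  by (rule recf_comp) (simp_all add: recf_def rf_left)

lemma recf_psnd [rec_intros]: "recf a \<Longrightarrow> recf (\<lambda>p n. psnd (a p n))"
  by (rule recf_comp) (simp_all add: recf_def rf_right)

lemma recf_Suc [rec_intros]: "recf a \<Longrightarrow> recf (\<lambda>p n. Suc (a p n))"
  by (rule recf_comp) (simp_all add: recf_def rf_succ)

lemma recf_prod_encode [rec_intros]:
  "recf a \<Longrightarrow> recf b \<Longrightarrow> recf (\<lambda>p n. prod_encode (a p n, b p n))"
  unfolding recf_def by (drule (1) rf_pair) simp

lemma recf_id [rec_intros]: "recf (\<lambda>p n. n)"
proof -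
  have "recursive_functional (\<lambda>p n. Some (prod_encode (pfst n, psnd n)))"
    using rf_pair[OF rf_left rf_right] by simp
  then show ?thesis by (simp add: recf_def)
qed

lemma recf_const [rec_intros]: "recf (\<lambda>p n. k)"
proof (induction k)
  case 0
  show ?case by (simp add: recf_def rf_zero)
qed (rule recf_Suc)

lemma recp_oracle [rec_intros]: "recf a \<Longrightarrow> recp (\<lambda>p n. p (a p n))"
  by (rule recp_comp[where P = "\<lambda>p n. p n"]) (simp_all add: recp_def recf_def rf_oracle)

lemma recf_of_bool [rec_intros]: "recp P \<Longrightarrow> recf (\<lambda>p n. of_bool (P p n))"
  by (simp add: recp_def)

text \<open>The whole argument \<open>n\<close> is handed to \<open>rf_prec\<close> as the
  parameter, so that the step function may depend on it.\<close>

lemma recf_rec_nat [rec_intros]: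
  assumes z: "recf z" and m: "recf m"
    and s: "recf (\<lambda>p x. s p (pfst x) (pfst (psnd x)) (psnd (psnd x)))"
  shows "recf (\<lambda>p n. rec_nat (z p n) (s p n) (m p n))"
proof -
  let ?G = "\<lambda>p x. Some (s p (pfst x) (pfst (psnd x)) (psnd (psnd x)))"
  have "recursive_functional (\<lambda>p n. case prod_decode n of (a, m) \<Rightarrow>
      rec_nat (Some (z p a))
        (\<lambda>k r. Option.bind r (\<lambda>i. ?G p (prod_encode (a, prod_encode (k, i))))) m)"
    using z s unfolding recf_def by (rule rf_prec)
  moreover have "rec_nat (Some (z p a))
        (\<lambda>k r. Option.bind r (\<lambda>i. ?G p (prod_encode (a, prod_encode (k, i))))) m =
      Some (rec_nat (z p a) (s p a) m)" for p a m
    by (induction m) simp_all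
  ultimately have "recf (\<lambda>p n. rec_nat (z p (pfst n)) (s p (pfst n)) (psnd n))"
    by (simp add: recf_def case_prod_beta)
  from recf_comp[OF this recf_prod_encode[OF recf_id m]] show ?thesis by simp
qed

lemma recf_add [rec_intros]: "recf a \<Longrightarrow> recf b \<Longrightarrow> recf (\<lambda>p n. a p n + b p n)"
proof -
  assume ab: "recf a" "recf b"
  have "rec_nat x (\<lambda>_ r. Suc r) y = x + y" for x y :: nat by (induction y) simp_all
  moreover have "recf (\<lambda>p n. rec_nat (a p n) (\<lambda>_ r. Suc r) (b p n))"
    by (intro recf_rec_nat ab recf_Suc recf_psnd recf_id)
  ultimately show ?thesis by simp
qed

lemma recf_mult [rec_intros]: "recf a \<Longrightarrow> recf b \<Longrightarrow> recf (\<lambda>p n. a p n * b p n)"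
proof -
  assume ab: "recf a" "recf b"
  have "rec_nat 0 (\<lambda>_ r. x + r) y = x * y" for x y :: nat by (induction y) simp_all
  moreover have "recf (\<lambda>p n. rec_nat 0 (\<lambda>_ r. a p n + r) (b p n))"
    by (intro recf_rec_nat recf_comp[OF ab(1)] ab(2) recf_add recf_psnd recf_pfst recf_id recf_const)
  ultimately show ?thesis by simp
qed

lemma recf_power [rec_intros]: "recf a \<Longrightarrow> recf b \<Longrightarrow> recf (\<lambda>p n. a p n ^ b p n)"
proof -
  assume ab: "recf a" "recf b"
  have "rec_nat 1 (\<lambda>_ r. x * r) y = x ^ y" for x y :: nat by (induction y) simp_all
  moreover have "recf (\<lambda>p n. rec_nat 1 (\<lambda>_ r. a p n * r) (b p n))"
    by (intro recf_rec_nat recf_comp[OF ab(1)] ab(2) recf_mult recf_psnd recf_pfst recf_id recf_const)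
  ultimately show ?thesis by simp
qed

lemma recf_diff [rec_intros]: "recf a \<Longrightarrow> recf b \<Longrightarrow> recf (\<lambda>p n. a p n - b p n)"
proof -
  assume ab: "recf a" "recf b"
  have pred: "recf (\<lambda>p n. c p n - 1)" if "recf c" for c
  proof -
    have "rec_nat 0 (\<lambda>k _. k) y = y - 1" for y :: nat by (cases y) simp_all
    moreover have "recf (\<lambda>p n. rec_nat 0 (\<lambda>k _. k) (c p n))"
      by (intro recf_rec_nat that recf_psnd recf_pfst recf_id recf_const)
    ultimately show ?thesis by simp
  qed
  have "rec_nat x (\<lambda>_ r. r - 1) y = x - y" for x y :: nat by (induction y) simp_all
  moreover have "recf (\<lambda>p n. rec_nat (a p n) (\<lambda>_ r. r - 1) (b p n))"
    by (intro recf_rec_nat ab pred recf_psnd recf_id)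
  ultimately show ?thesis by simp
qed

lemma recp_less [rec_intros]: "recf a \<Longrightarrow> recf b \<Longrightarrow> recp (\<lambda>p n. a p n < b p n)"
proof -
  assume ab: "recf a" "recf b"
  have "1 - (1 - (y - x)) = (of_bool (x < y) :: nat)" for x y :: nat by simp
  moreover have "recf (\<lambda>p n. 1 - (1 - (b p n - a p n)))"
    by (intro recf_diff recf_const ab)
  ultimately show ?thesis by (simp add: recp_def)
qed

lemma recp_not [rec_intros]: "recp P \<Longrightarrow> recp (\<lambda>p n. \<not> P p n)"
proof -
  assume "recp P"
  then have "recf (\<lambda>p n. 1 - of_bool (P p n))" by (intro rec_intros)
  moreover have "1 - of_bool x = (of_bool (\<not> x) :: nat)" for x by (cases x) simp_all
  ultimately show ?thesis by (simp add: recp_def)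
qed

lemma recp_conj [rec_intros]: "recp P \<Longrightarrow> recp Q \<Longrightarrow> recp (\<lambda>p n. P p n \<and> Q p n)"
  unfolding recp_def of_bool_conj by (rule recf_mult)

lemma recp_disj [rec_intros]: "recp P \<Longrightarrow> recp Q \<Longrightarrow> recp (\<lambda>p n. P p n \<or> Q p n)"
proof -
  assume "recp P" "recp Q"
  then have "recp (\<lambda>p n. \<not> (\<not> P p n \<and> \<not> Q p n))" by (intro recp_not recp_conj)
  then show ?thesis by simp
qed

lemma recp_imp [rec_intros]: "recp P \<Longrightarrow> recp Q \<Longrightarrow> recp (\<lambda>p n. P p n \<longrightarrow> Q p n)"
  unfolding imp_conv_disj by (intro recp_disj recp_not)

lemma recp_iff [rec_intros]: "recp P \<Longrightarrow> recp Q \<Longrightarrow> recp (\<lambda>p n. P p n \<longleftrightarrow> Q p n)"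
  unfolding iff_conv_conj_imp by (intro recp_conj recp_imp)

lemma recp_le [rec_intros]: "recf a \<Longrightarrow> recf b \<Longrightarrow> recp (\<lambda>p n. a p n \<le> b p n)"
  unfolding not_less[symmetric] by (intro recp_not recp_less)

lemma recp_eq [rec_intros]: "recf a \<Longrightarrow> recf b \<Longrightarrow> recp (\<lambda>p n. a p n = b p n)"
  unfolding eq_iff by (intro recp_conj recp_le)

lemma recp_ex_less [rec_intros]:
  assumes b: "recf b" and P: "recp (\<lambda>p x. P p (pfst x) (psnd x))"
  shows "recp (\<lambda>p n. \<exists>k<b p n. P p n k)"
proof -
  have "rec_nat 0 (\<lambda>k r. of_bool (0 < r \<or> Q k)) m = (of_bool (\<exists>k<m. Q k) :: nat)" for Q m
    by (induction m) (auto simp: less_Suc_eq)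
  moreover have "recf (\<lambda>p n. rec_nat 0 (\<lambda>k r. of_bool (0 < r \<or> P p n k)) (b p n))"
  proof (intro recf_rec_nat b recf_of_bool recp_disj recp_less recf_const recf_psnd recf_id)
    have "recp (\<lambda>p n. (\<lambda>p x. P p (pfst x) (psnd x)) p (prod_encode (pfst n, pfst (psnd n))))"
      by (rule recp_comp[OF P]) (intro rec_intros)
    then show "recp (\<lambda>p n. P p (pfst n) (pfst (psnd n)))" by simp
  qed
  ultimately show ?thesis by (simp add: recp_def)
qed

lemma recp_all_less [rec_intros]:
  assumes "recf b" and "recp (\<lambda>p x. P p (pfst x) (psnd x))"
  shows "recp (\<lambda>p n. \<forall>k<b p n. P p n k)"
proof -
  have "recp (\<lambda>p n. \<not> (\<exists>k<b p n. \<not> P p n k))" using assms by (intro recp_not recp_ex_less)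
  then show ?thesis by simp
qed

lemma recp_ex_le [rec_intros]:
  assumes "recf b" and "recp (\<lambda>p x. P p (pfst x) (psnd x))"
  shows "recp (\<lambda>p n. \<exists>k\<le>b p n. P p n k)"
  unfolding less_Suc_eq_le[symmetric] using assms by (intro recp_ex_less recf_Suc)

text \<open>The search operator wants all values before the first zero to be defined and positive.
  With truth coded as zero, a total predicate meets this at its least witness.\<close>

lemma recf_Least_partial:
  assumes P: "recp (\<lambda>p x. P p (pfst x) (psnd x))"
  shows "recursive_functional (\<lambda>p n. if \<exists>k. P p n k then Some (LEAST k. P p n k) else None)"
proof -
  let ?F = "\<lambda>p x. Some (of_bool (\<not> P p (pfst x) (psnd x)) :: nat)"
  have "recursive_functional ?F"
    using recp_not[OF P] by (simp add: recp_def recf_def)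
  have [simp]: "(\<exists>v. of_bool (\<not> b) = Suc v) \<longleftrightarrow> \<not> b" for b by (cases b) auto
  from rf_mu[OF \<open>recursive_functional ?F\<close>]
  have "recursive_functional (\<lambda>p a. if \<exists>n. P p a n \<and> (\<forall>m<n. \<not> P p a m)
      then Some (LEAST n. P p a n) else None)"
    by (simp cong: if_cong)
  moreover have "(\<exists>n. Q n \<and> (\<forall>m<n. \<not> Q m)) \<longleftrightarrow> (\<exists>n. Q n)" for Q :: "nat \<Rightarrow> bool"
    using exists_least_iff by metis
  ultimately show ?thesis by simp
qed

lemma recf_Least:
  assumes "recp (\<lambda>p x. P p (pfst x) (psnd x))" and "\<And>p n. \<exists>k. P p n k"
  shows "recf (\<lambda>p n. LEAST k. P p n k)"
  using recf_Least_partial[OF assms(1)] assms(2) by (simp add: recf_def)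

lemma recf_div [rec_intros]:
  assumes ab: "recf a" "recf b"
  shows "recf (\<lambda>p n. a p n div b p n)"
proof -
  \<comment> \<open>The disjunct \<open>y = 0\<close> makes the search stop at 0, the value of
    division by zero.\<close>
  have "(LEAST q. y = 0 \<or> x < y * Suc q) = x div y" for x y :: nat
  proof (cases "y = 0")
    case False
    show ?thesis
    proof (rule Least_equality)
      show "y = 0 \<or> x < y * Suc (x div y)"
        using False dividend_less_times_div by auto
      show "x div y \<le> q" if "y = 0 \<or> x < y * Suc q" for q
        using that False less_mult_imp_div_less[of x "Suc q" y] by (simp add: mult.commute)
    qed
  qed simp
  moreover have "recf (\<lambda>p n. LEAST q. b p n = 0 \<or> a p n < b p n * Suc q)"
  proof (rule recf_Least)
    show "recp (\<lambda>p x. b p (pfst x) = 0 \<or> a p (pfst x) < b p (pfst x) * Suc (psnd x))"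
      by (intro recp_disj recp_eq recp_less recf_mult recf_Suc recf_psnd recf_const recf_id
          recf_comp[OF ab(1)] recf_comp[OF ab(2)] recf_pfst)
    show "\<exists>q. b p n = 0 \<or> a p n < b p n * Suc q" for p n
      using dividend_less_times_div[of "b p n" "a p n"] by auto
  qed
  ultimately show ?thesis by simp
qed

lemma recf_mod [rec_intros]: "recf a \<Longrightarrow> recf b \<Longrightarrow> recf (\<lambda>p n. a p n mod b p n)"
  unfolding minus_div_mult_eq_mod[symmetric] by (intro recf_diff recf_mult recf_div)

lemma recp_even [rec_intros]: "recf a \<Longrightarrow> recp (\<lambda>p n. even (a p n))"
  unfolding even_iff_mod_2_eq_zero by (intro recp_eq recf_mod recf_const)

lemma recf_If [rec_intros]:
  assumes "recp P" "recf a" "recf b"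
  shows "recf (\<lambda>p n. if P p n then a p n else b p n)"
proof -
  have "recf (\<lambda>p n. of_bool (P p n) * a p n + of_bool (\<not> P p n) * b p n)"
    using assms by (intro rec_intros)
  moreover have "of_bool c * x + of_bool (\<not> c) * y = (if c then x else y)" for c and x y :: nat
    by simp
  ultimately show ?thesis by simp
qed

lemma recp_If [rec_intros]:
  assumes "recp P" "recp Q" "recp Q'"
  shows "recp (\<lambda>p n. if P p n then Q p n else Q' p n)"
  unfolding if_bool_eq_conj using assms by (intro rec_intros)

text \<open>This makes quantifiers over coded finite sets bounded, hence decidable. It also keeps
  the members of a cover coded by \<open>L \<le> cut (Suc n)\<close> below that cut.\<close>

lemma mem_set_decode_less: "k \<in> set_decode L \<Longrightarrow> k < L"
proof -
  assume "k \<in> set_decode L"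
  then have "2 ^ k \<le> L"
    unfolding set_decode_def by (metis div_less even_zero mem_Collect_eq not_less)
  then show ?thesis by (rule less_le_trans[OF less_exp])
qed

lemma recp_mem_set_decode [rec_intros]:
  "recf a \<Longrightarrow> recf b \<Longrightarrow> recp (\<lambda>p n. a p n \<in> set_decode (b p n))"
  unfolding set_decode_def mem_Collect_eq by (intro recp_not recp_even recf_div recf_power recf_const)

lemma recp_bex_set_decode [rec_intros]:
  assumes b: "recf b" and P: "recp (\<lambda>p x. P p (pfst x) (psnd x))"
  shows "recp (\<lambda>p n. \<exists>k\<in>set_decode (b p n). P p n k)"
proof -
  have "(\<exists>k\<in>set_decode L. Q k) \<longleftrightarrow> (\<exists>k<L. k \<in> set_decode L \<and> Q k)" for L Q
    using mem_set_decode_less by blast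
  moreover have "recp (\<lambda>p n. \<exists>k<b p n. k \<in> set_decode (b p n) \<and> P p n k)"
    by (intro recp_ex_less b recp_conj P recp_mem_set_decode recf_psnd recf_pfst recf_id
        recf_comp[OF b])
  ultimately show ?thesis by simp
qed

lemma recp_ball_set_decode [rec_intros]:
  assumes "recf b" and "recp (\<lambda>p x. P p (pfst x) (psnd x))"
  shows "recp (\<lambda>p n. \<forall>k\<in>set_decode (b p n). P p n k)"
proof -
  have "recp (\<lambda>p n. \<not> (\<exists>k\<in>set_decode (b p n). \<not> P p n k))"
    using assms by (intro recp_not recp_bex_set_decode)
  then show ?thesis by simp
qed

lemma recf_comp2:
  assumes "recf (\<lambda>p x. g p (pfst x) (psnd x))" "recf a" "recf b"
  shows "recf (\<lambda>p n. g p (a p n) (b p n))"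
  using recf_comp[OF assms(1) recf_prod_encode[OF assms(2,3)]] by simp

lemma recp_comp2:
  assumes "recp (\<lambda>p x. P p (pfst x) (psnd x))" "recf a" "recf b"
  shows "recp (\<lambda>p n. P p (a p n) (b p n))"
  using recp_comp[OF assms(1) recf_prod_encode[OF assms(2,3)]] by simp

lemma recursive_functional_bind_total:
  assumes A: "recursive_functional A" and g: "recf (\<lambda>p x. g p (pfst x) (psnd x))"
  shows "recursive_functional (\<lambda>p n. Option.bind (A p n) (\<lambda>a. Some (g p a n)))"
proof -
  have "recursive_functional (\<lambda>p n. Some n)" using recf_id by (simp add: recf_def)
  from rf_comp[OF g[unfolded recf_def] rf_pair[OF A this]]
  show ?thesis by (simp add: bind_assoc cong: bind_option_cong)
qed

section \<open>Oracle substitution and continuity\<close>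

text \<open>A realizer reads its input as an oracle; here it is run on an input that is itself
  computed, uniformly in a parameter. The parameter travels in the first component of every
  argument, so recursion and search need their arguments regrouped.\<close>

lemma recursive_functional_subst:
  assumes "recursive_functional F" and G: "recp (\<lambda>p x. G p (pfst x) (psnd x))"
  shows "recursive_functional (\<lambda>p n. F (G p (pfst n)) (psnd n))"
  using assms(1)
proof induction
  case rf_oracle
  then show ?case using G by (simp add: recp_def recf_def)
next
  case rf_zero
  then show ?case by (rule recursive_functional.rf_zero)
next
  case rf_succ
  have "recf (\<lambda>p n. Suc (psnd n))" by (intro rec_intros)
  then show ?case by (simp add: recf_def)
next
  case rf_left
  have "recf (\<lambda>p n. pfst (psnd n))" by (intro rec_intros)
  then show ?case by (simp add: recf_def)
next
  case rf_right
  have "recf (\<lambda>p n. psnd (psnd n))" by (intro rec_intros)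
  then show ?case by (simp add: recf_def)
next
  case (rf_pair F G)
  then show ?case by (intro recursive_functional.rf_pair)
next
  case (rf_comp F H)
  have "recursive_functional (\<lambda>p n. Some (pfst n))" by (rule rf_left)
  from recursive_functional.rf_comp[OF rf_comp.IH(1) recursive_functional.rf_pair[OF this rf_comp.IH(2)]]
  show ?case by (simp add: bind_assoc cong: bind_option_cong)
next
  case (rf_prec F H)
  have r: "recursive_functional (\<lambda>p x. Some (prod_encode (pfst (pfst x),
      prod_encode (psnd (pfst x), psnd x))))"
    unfolding recf_def[symmetric] by (intro rec_intros)
  have "recursive_functional (\<lambda>p x. H (G p (pfst (pfst x))) (prod_encode (psnd (pfst x), psnd x)))"
    using recursive_functional.rf_comp[OF rf_prec.IH(2) r] by simp
  from recursive_functional.rf_prec[OF rf_prec.IH(1) this]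
  have *: "recursive_functional (\<lambda>p n. rec_nat (F (G p (pfst (pfst n))) (psnd (pfst n)))
        (\<lambda>k r. Option.bind r (\<lambda>i. H (G p (pfst (pfst n)))
          (prod_encode (psnd (pfst n), prod_encode (k, i))))) (psnd n))"
    by (simp add: case_prod_beta)
  have "recursive_functional (\<lambda>p n. Some (prod_encode (prod_encode (pfst n, pfst (psnd n)), psnd (psnd n))))"
    unfolding recf_def[symmetric] by (intro rec_intros)
  from recursive_functional.rf_comp[OF * this] show ?case by (simp add: case_prod_beta)
next
  case (rf_mu F)
  have r: "recursive_functional (\<lambda>p x. Some (prod_encode (pfst (pfst x),
      prod_encode (psnd (pfst x), psnd x))))"
    unfolding recf_def[symmetric] by (intro rec_intros)
  have "recursive_functional (\<lambda>p x. F (G p (pfst (pfst x))) (prod_encode (psnd (pfst x), psnd x)))"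
    using recursive_functional.rf_comp[OF rf_mu.IH r] by simp
  from recursive_functional.rf_mu[OF this] show ?case by (simp cong: if_cong)
qed

text \<open>A terminating computation consults finitely many oracle values. For the search operator
  these include the ones behind every value tested up to the hit, which is why their bounds are
  summed.\<close>

lemma recursive_functional_continuous:
  assumes "recursive_functional F" "F p n = Some v"
  shows "\<exists>N. \<forall>p'. (\<forall>j<N. p' j = p j) \<longrightarrow> F p' n = Some v"
  using assms
proof (induction arbitrary: n v)
  case rf_oracle
  then show ?case by (intro exI[of _ "Suc n"]) auto
next
  case (rf_pair F G)
  from rf_pair.prems obtain a b where ab: "F p n = Some a" "G p n = Some b"
    "v = prod_encode (a, b)" by (auto simp: bind_eq_Some_conv)
  obtain N where N: "\<forall>p'. (\<forall>j<N. p' j = p j) \<longrightarrow> F p' n = Some a"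
    using rf_pair.IH(1)[OF ab(1)] ..
  obtain M where M: "\<forall>p'. (\<forall>j<M. p' j = p j) \<longrightarrow> G p' n = Some b"
    using rf_pair.IH(2)[OF ab(2)] ..
  show ?case using ab N M by (intro exI[of _ "max N M"]) simp
next
  case (rf_comp F G)
  from rf_comp.prems obtain a where ab: "G p n = Some a" "F p a = Some v"
    by (auto simp: bind_eq_Some_conv)
  obtain N where N: "\<forall>p'. (\<forall>j<N. p' j = p j) \<longrightarrow> G p' n = Some a"
    using rf_comp.IH(2)[OF ab(1)] ..
  obtain M where M: "\<forall>p'. (\<forall>j<M. p' j = p j) \<longrightarrow> F p' a = Some v"
    using rf_comp.IH(1)[OF ab(2)] ..
  show ?case using N M by (intro exI[of _ "max N M"]) simp
next
  case (rf_prec F G)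
  obtain a m where am: "prod_decode n = (a, m)" by fastforce
  let ?r = "\<lambda>p m. rec_nat (F p a)
        (\<lambda>k r. Option.bind r (\<lambda>i. G p (prod_encode (a, prod_encode (k, i))))) m"
  have "\<exists>N. \<forall>p'. (\<forall>j<N. p' j = p j) \<longrightarrow> ?r p' m = Some v" if "?r p m = Some v" for m v
    using that
  proof (induction m arbitrary: v)
    case 0
    then show ?case using rf_prec.IH(1) by simp
  next
    case (Suc m)
    from Suc.prems obtain i where i: "?r p m = Some i"
      "G p (prod_encode (a, prod_encode (m, i))) = Some v"
      by (auto simp: bind_eq_Some_conv)
    obtain N where N: "\<forall>p'. (\<forall>j<N. p' j = p j) \<longrightarrow> ?r p' m = Some i"
      using Suc.IH[OF i(1)] ..
    obtain M where M: "\<forall>p'. (\<forall>j<M. p' j = p j) \<longrightarrow>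
        G p' (prod_encode (a, prod_encode (m, i))) = Some v"
      using rf_prec.IH(2)[OF i(2)] ..
    show ?case using N M by (intro exI[of _ "max N M"]) simp
  qed
  then show ?case using rf_prec.prems am by simp
next
  case (rf_mu F)
  let ?Q = "\<lambda>p k. F p (prod_encode (n, k)) = Some 0 \<and>
             (\<forall>m<k. \<exists>v. F p (prod_encode (n, m)) = Some (Suc v))"
  have L: "(LEAST k. F p (prod_encode (n, k)) = Some 0) = k" if "?Q p k" for p k
    using that by (intro Least_equality) (auto simp: not_less[symmetric])
  from rf_mu.prems obtain k where k: "?Q p k" by (auto split: if_splits)
  with rf_mu.prems L have v: "v = k" by (auto split: if_splits)
  have "\<forall>m\<in>{..k}. \<exists>N. \<forall>p'. (\<forall>j<N. p' j = p j) \<longrightarrow>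
      F p' (prod_encode (n, m)) = F p (prod_encode (n, m))"
  proof
    fix m assume "m \<in> {..k}"
    then obtain u where "F p (prod_encode (n, m)) = Some u" using k by (metis atMost_iff nat_less_le)
    then show "\<exists>N. \<forall>p'. (\<forall>j<N. p' j = p j) \<longrightarrow> F p' (prod_encode (n, m)) = F p (prod_encode (n, m))"
      using rf_mu.IH by metis
  qed
  then obtain N where N: "\<And>m p'. m \<le> k \<Longrightarrow> (\<forall>j<N m. p' j = p j) \<Longrightarrow>
      F p' (prod_encode (n, m)) = F p (prod_encode (n, m))"
    by (metis atMost_iff)
  show ?case
  proof (intro exI[of _ "\<Sum>m\<le>k. N m"] allI impI)
    fix p' assume "\<forall>j<(\<Sum>m\<le>k. N m). p' j = p j"
    then have "F p' (prod_encode (n, m)) = F p (prod_encode (n, m))" if "m \<le> k" for m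
      using N[OF that] member_le_sum[of m "{..k}" N] that by (meson atMost_iff finite_atMost order_less_le_trans zero_le)
    then have "?Q p' k" using k by simp
    then show "(if \<exists>k. ?Q p' k then Some (LEAST k. F p' (prod_encode (n, k)) = Some 0) else None) = Some v"
      using L[of p' k] v by auto
  qed
qed auto


section \<open>Codes of binary words\<close>

text \<open>In binary, \<open>Suc c\<close> is the word with its first letter as lowest bit, below a
  leading one. Hence length is a logarithm, letters are bits, and a prefix consists of the low bits
  under a new leading one.\<close>

definition code_len :: "nat \<Rightarrow> nat" where
  "code_len c = (LEAST n. Suc c < 2 ^ Suc n)"

definition code_bit :: "nat \<Rightarrow> nat \<Rightarrow> bool" where
  "code_bit c j \<longleftrightarrow> odd (Suc c div 2 ^ j)"

definition code_take :: "nat \<Rightarrow> nat \<Rightarrow> nat" where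
  "code_take k c = Suc c mod 2 ^ k + 2 ^ k - 1"

lemma Suc_word_code_Cons: "Suc (word_code (b # w)) = 2 * Suc (word_code w) + of_bool b"
  by simp

lemma code_len_word_code: "code_len (word_code w) = length w"
proof -
  have b: "2 ^ length w \<le> Suc (word_code w) \<and> Suc (word_code w) < 2 ^ Suc (length w)"
    by (induction w) auto
  show ?thesis unfolding code_len_def
  proof (rule Least_equality)
    show "length w \<le> n" if "Suc (word_code w) < 2 ^ Suc n" for n
    proof -
      have "(2::nat) ^ length w < 2 ^ Suc n" using b that by linarith
      then show ?thesis by (simp only: power_strict_increasing_iff one_less_numeral_iff semiring_norm less_Suc_eq_le)
    qed
  qed (use b in blast)
qed

lemma code_bit_word_code: "j < length w \<Longrightarrow> code_bit (word_code w) j = w ! j"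
proof (induction w arbitrary: j)
  case (Cons b w)
  show ?case
  proof (cases j)
    case 0
    then show ?thesis unfolding code_bit_def Suc_word_code_Cons by simp
  next
    case (Suc i)
    have "Suc (word_code (b # w)) div 2 ^ j = Suc (word_code w) div 2 ^ i"
      unfolding Suc_word_code_Cons Suc power_Suc div_mult2_eq by simp
    then show ?thesis using Cons Suc unfolding code_bit_def by simp
  qed
qed simp

lemma code_take_word_code: "k \<le> length w \<Longrightarrow> code_take k (word_code w) = word_code (take k w)"
proof (induction w arbitrary: k)
  case Nil
  then show ?case by (simp add: code_take_def)
next
  case (Cons b w)
  show ?case
  proof (cases k)
    case 0
    then show ?thesis by (simp add: code_take_def)
  next
    case (Suc i)
    have "Suc (word_code (b # w)) mod 2 ^ k = 2 * (Suc (word_code w) mod 2 ^ i) + of_bool b"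
      unfolding Suc_word_code_Cons Suc power_Suc mod_mult2_eq by simp
    moreover have "Suc (word_code w) mod 2 ^ i + 2 ^ i = Suc (word_code (take i w))"
    proof -
      have "Suc (word_code w) mod 2 ^ i + 2 ^ i - 1 = word_code (take i w)"
        using Cons Suc by (simp add: code_take_def)
      moreover have "(2::nat) ^ i \<ge> 1" by simp
      ultimately show ?thesis by linarith
    qed
    ultimately show ?thesis using Suc unfolding code_take_def by (cases b) auto
  qed
qed

lemma length_le_word_code: "length w \<le> word_code w"
  by (induction w) auto

lemma length_initial_segment [simp]: "length (initial_segment q k) = k"
  by (simp add: initial_segment_def)

lemma take_initial_segment: "j \<le> k \<Longrightarrow> take j (initial_segment q k) = initial_segment q j"
  by (simp add: initial_segment_def take_map)

lemma recf_code_len [rec_intros]: "recf a \<Longrightarrow> recf (\<lambda>p n. code_len (a p n))"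
proof (rule recf_comp[where f = "\<lambda>p. code_len"])
  have "\<exists>n. Suc c < 2 ^ Suc n" for c :: nat
    using less_exp[of "Suc c"] by (metis less_exp less_trans lessI)
  then show "recf (\<lambda>p. code_len)"
    unfolding code_len_def by (intro recf_Least rec_intros)
qed

lemma recp_code_bit [rec_intros]: "recf a \<Longrightarrow> recf b \<Longrightarrow> recp (\<lambda>p n. code_bit (a p n) (b p n))"
  unfolding code_bit_def by (intro rec_intros)

lemma recf_code_take [rec_intros]: "recf a \<Longrightarrow> recf b \<Longrightarrow> recf (\<lambda>p n. code_take (a p n) (b p n))"
  unfolding code_take_def by (intro rec_intros)


section \<open>Acceptors of open sets\<close>

text \<open>A set of prefixes that witness membership carries the same information as an associate
  into Sierpinski space, but turns unions and finite intersections into disjunctions and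
  conjunctions.\<close>

definition accepts :: "'a repspace \<Rightarrow> (nat \<Rightarrow> bool) \<Rightarrow> 'a set \<Rightarrow> bool" where
  "accepts X B U \<longleftrightarrow> U \<subseteq> points X \<and>
     (\<forall>q x. X q = Some x \<longrightarrow> (x \<in> U \<longleftrightarrow> (\<exists>k. B (word_code (initial_segment q k)))))"

text \<open>Needed for intersections: one and the same prefix has to satisfy all conjuncts, so
  acceptance must persist along longer prefixes.\<close>

definition mono_acceptor :: "(nat \<Rightarrow> bool) \<Rightarrow> bool" where
  "mono_acceptor B \<longleftrightarrow> (\<forall>q j k. j \<le> k \<longrightarrow> B (word_code (initial_segment q j)) \<longrightarrow>
     B (word_code (initial_segment q k)))"

text \<open>The output index \<open>m\<close> is bounded by the length of the prefix to stay
  decidable; every index is reached as the prefix grows.\<close>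

definition acc_of :: "cantor \<Rightarrow> nat \<Rightarrow> bool" where
  "acc_of p c \<longleftrightarrow> (\<exists>m<Suc (code_len c). \<exists>j<Suc (code_len c).
     p (2 * prod_encode (code_take j c, m)) \<and>
     (\<forall>i<j. \<not> p (2 * prod_encode (code_take i c, m))) \<and>
     p (2 * prod_encode (code_take j c, m) + 1))"

text \<open>This associate answers output bit \<open>n\<close> after exactly \<open>n\<close> input
  bits, with the verdict of \<open>B\<close> on the prefix read.\<close>

definition assoc_of :: "(nat \<Rightarrow> bool) \<Rightarrow> cantor" where
  "assoc_of B N \<longleftrightarrow> (if even N then code_len (pfst (N div 2)) = psnd (N div 2)
     else B (pfst (N div 2)))"

lemma acc_of_initial_segment:
  "acc_of p (word_code (initial_segment q k)) \<longleftrightarrow> (\<exists>m\<le>k. \<exists>j\<le>k.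
     p (2 * prod_encode (word_code (initial_segment q j), m)) \<and>
     (\<forall>i<j. \<not> p (2 * prod_encode (word_code (initial_segment q i), m))) \<and>
     p (2 * prod_encode (word_code (initial_segment q j), m) + 1))"
  unfolding acc_of_def code_len_word_code length_initial_segment less_Suc_eq_le
  by (intro ex_cong1 conj_cong refl)
    (simp_all add: code_take_word_code take_initial_segment)

lemma mono_acc_of: "mono_acceptor (acc_of p)"
  unfolding mono_acceptor_def acc_of_initial_segment by (meson order_trans)

lemma open_rep_imp_accepts:
  assumes "open_rep X p = Some U"
  shows "accepts X (acc_of p) U"
proof -
  from assms obtain h where h: "fun_name X sierp_rep p h" and U: "U = {x \<in> points X. h x}"
    by (auto simp: open_rep_def fun_rep_eq_Some_iff)
  have "x \<in> U \<longleftrightarrow> (\<exists>k. acc_of p (word_code (initial_segment q k)))" if q: "X q = Some x" for q x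
  proof -
    from h q have "\<exists>r. associate_app p q r \<and> sierp_rep r = Some (h x)"
      by (simp add: fun_name_def)
    then obtain r where r: "associate_app p q r" "h x \<longleftrightarrow> (\<exists>n. r n)"
      by (auto simp: sierp_rep_def)
    let ?c = "\<lambda>j m. 2 * prod_encode (word_code (initial_segment q j), m)"
    have a: "\<exists>k. p (?c k n) \<and> (\<forall>j<k. \<not> p (?c j n)) \<and> r n = p (?c k n + 1)" for n
      using r(1) by (simp add: associate_app_def Let_def)
    have "(\<exists>k. acc_of p (word_code (initial_segment q k))) \<longleftrightarrow>
      (\<exists>m j. p (?c j m) \<and> (\<forall>i<j. \<not> p (?c i m)) \<and> p (?c j m + 1))"
      unfolding acc_of_initial_segment by (meson max.cobounded1 max.cobounded2)
    also have "\<dots> \<longleftrightarrow> (\<exists>n. r n)"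
    proof (intro ex_cong1)
      fix m
      obtain k where k: "p (?c k m)" "\<forall>j<k. \<not> p (?c j m)" "r m = p (?c k m + 1)"
        using a by blast
      show "(\<exists>j. p (?c j m) \<and> (\<forall>i<j. \<not> p (?c i m)) \<and> p (?c j m + 1)) \<longleftrightarrow> r m"
        using k by (metis linorder_neqE_nat)
    qed
    finally show ?thesis using r(2) q U by (auto intro: ranI)
  qed
  then show ?thesis using U by (auto simp: accepts_def)
qed

lemma accepts_imp_open_rep:
  assumes "accepts X B U"
  shows "open_rep X (assoc_of B) = Some U"
proof -
  have "fun_name X sierp_rep (assoc_of B) (restrict (\<lambda>x. x \<in> U) (points X))"
    unfolding fun_name_def
  proof (intro conjI allI impI)
    fix q x assume q: "X q = Some x"
    let ?r = "\<lambda>n. B (word_code (initial_segment q n))"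
    have "associate_app (assoc_of B) q ?r"
      unfolding associate_app_def Let_def assoc_of_def by (auto simp: code_len_word_code)
    moreover have "sierp_rep ?r = Some (restrict (\<lambda>x. x \<in> U) (points X) x)"
      using assms q by (auto simp: accepts_def sierp_rep_def intro: ranI)
    ultimately show "\<exists>r. associate_app (assoc_of B) q r \<and>
        sierp_rep r = Some (restrict (\<lambda>x. x \<in> U) (points X) x)" by blast
  qed simp
  then have "open_rep X (assoc_of B) = Some {x \<in> points X. restrict (\<lambda>x. x \<in> U) (points X) x}"
    unfolding open_rep_def by (simp add: fun_rep_eq_Some_iff[THEN iffD2])
  also have "{x \<in> points X. restrict (\<lambda>x. x \<in> U) (points X) x} = U"
    using assms by (auto simp: accepts_def)
  finally show ?thesis .
qed

text \<open>Relative to the domain of the representation, the preimage of \<open>U\<close> is the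
  union of the cylinders of the accepted words.\<close>

lemma accepts_imp_openin:
  assumes "accepts X B U"
  shows "openin (rep_topology X) U"
  unfolding openin_rep_topology
proof
  show "U \<subseteq> points X" using assms by (simp add: accepts_def)
  let ?V = "\<Union>w\<in>{w. B (word_code w)}. {p. \<forall>j<length w. p j = w ! j}"
  have seg: "p \<in> {p. \<forall>j<length w. p j = w ! j} \<longleftrightarrow> initial_segment p (length w) = w" for p w
    unfolding initial_segment_def mem_Collect_eq list_eq_iff_nth_eq by simp
  have "openin cantor_topology ?V"
  proof (intro openin_Union, safe)
    fix w :: "bool list"
    have "{p. \<forall>j<length w. p j = w ! j} = Pi\<^sub>E UNIV (\<lambda>j. if j < length w then {w ! j} else UNIV)"
      by (auto simp: PiE_UNIV_domain Pi_iff split: if_splits)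
    moreover have "openin cantor_topology (Pi\<^sub>E UNIV (\<lambda>j. if j < length w then {w ! j} else UNIV))"
      unfolding cantor_topology_def
      by (rule product_topology_basis) (auto intro: finite_subset[of _ "{..<length w}"])
    ultimately show "openin cantor_topology {p. \<forall>j<length w. p j = w ! j}" by simp
  qed
  moreover have "{p \<in> dom X. the (X p) \<in> U} = ?V \<inter> dom X"
  proof -
    have "the (X p) \<in> U \<longleftrightarrow> p \<in> ?V" if "p \<in> dom X" for p
    proof -
      have "the (X p) \<in> U \<longleftrightarrow> (\<exists>k. B (word_code (initial_segment p k)))"
        using assms that by (auto simp: accepts_def)
      also have "\<dots> \<longleftrightarrow> (\<exists>w. B (word_code w) \<and> initial_segment p (length w) = w)"
        by (metis length_initial_segment)
      finally show ?thesis using seg by simp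
    qed
    then show ?thesis by blast
  qed
  ultimately show "openin (subtopology cantor_topology (dom X)) {p \<in> dom X. the (X p) \<in> U}"
    by (auto simp: openin_subtopology)
qed

lemma accepts_Bex:
  assumes "\<And>l. l \<in> T \<Longrightarrow> accepts X (A l) (U l)"
  shows "accepts X (\<lambda>u. \<exists>l\<in>T. A l u) (\<Union>l\<in>T. U l)"
  using assms unfolding accepts_def by blast

lemma accepts_Ball:
  assumes "finite T" "\<And>l. l \<in> T \<Longrightarrow> accepts X (A l) (U l)" "\<And>l. l \<in> T \<Longrightarrow> mono_acceptor (A l)"
  shows "accepts X (\<lambda>u. \<forall>l\<in>T. A l u) {x \<in> points X. \<forall>l\<in>T. x \<in> U l}"
  unfolding accepts_def
proof (intro conjI allI impI)
  fix q x assume q: "X q = Some x"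
  let ?B = "\<lambda>l k. A l (word_code (initial_segment q k))"
  have "(\<forall>l\<in>T. \<exists>k. ?B l k) \<longleftrightarrow> (\<exists>k. \<forall>l\<in>T. ?B l k)"
  proof
    assume "\<forall>l\<in>T. \<exists>k. ?B l k"
    then obtain k where k: "\<And>l. l \<in> T \<Longrightarrow> ?B l (k l)" by metis
    have "?B l (Max (k ` T))" if "l \<in> T" for l
      using k[OF that] assms(3)[OF that] that \<open>finite T\<close>
      unfolding mono_acceptor_def by (meson Max_ge finite_imageI imageI)
    then show "\<exists>k. \<forall>l\<in>T. ?B l k" by blast
  qed blast
  moreover have "x \<in> U l \<longleftrightarrow> (\<exists>k. ?B l k)" if "l \<in> T" for l
    using assms(2)[OF that] q by (simp add: accepts_def)
  ultimately show "x \<in> {x \<in> points X. \<forall>l\<in>T. x \<in> U l} \<longleftrightarrow> (\<exists>k. \<forall>l\<in>T. ?B l k)"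
    using q by (auto intro: ranI)
qed auto

lemma mono_acceptor_Ball: "(\<And>l. l \<in> T \<Longrightarrow> mono_acceptor (A l)) \<Longrightarrow> mono_acceptor (\<lambda>u. \<forall>l\<in>T. A l u)"
  unfolding mono_acceptor_def by meson

lemma accepts_conj_const: "accepts X B U \<Longrightarrow> accepts X (\<lambda>u. b \<and> B u) (if b then U else {})"
  by (auto simp: accepts_def)

lemma accepts_disj_const: "accepts X B U \<Longrightarrow> accepts X (\<lambda>u. b \<or> B u) (if b then points X else U)"
  by (auto simp: accepts_def intro: ranI)

lemma accepts_disj: "accepts X B U \<Longrightarrow> accepts X B' U' \<Longrightarrow> accepts X (\<lambda>u. B u \<or> B' u) (U \<union> U')"
  unfolding accepts_def by blast

lemma recp_acc_of [rec_intros]: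
  assumes Q: "recp (\<lambda>p x. Q p (pfst x) (psnd x))" and a: "recf a"
  shows "recp (\<lambda>p n. acc_of (Q p n) (a p n))"
  unfolding acc_of_def by (intro rec_intros recp_comp2[OF Q] recf_comp[OF a] a)

lemma recp_assoc_of [rec_intros]:
  assumes B: "recp (\<lambda>p x. B p (pfst x) (psnd x))" and a: "recf a"
  shows "recp (\<lambda>p n. assoc_of (B p n) (a p n))"
  unfolding assoc_of_def by (intro rec_intros recp_comp2[OF B] recf_comp[OF a] a)


section \<open>Compact Hausdorff spaces with a proper dyadic subbase\<close>

definition neg :: "nat \<Rightarrow> nat" where
  "neg l = (if even l then l + 1 else l - 1)"

definition lits :: "nat \<Rightarrow> nat set" where
  "lits c = set_decode (pfst c)"

lemma neg_literal: "neg (2 * k + of_bool i) = 2 * k + of_bool (\<not> i)"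
  by (cases i) (simp_all add: neg_def)

lemma literal_decode: "(l::nat) = 2 * (l div 2) + of_bool (odd l)"
  by (cases "even l") auto

lemma finite_lits [simp]: "finite (lits c)"
  by (simp add: lits_def)

lemma lits_prod_encode: "finite T \<Longrightarrow> lits (prod_encode (set_encode T, k)) = T"
  by (simp add: lits_def)

lemma recf_neg [rec_intros]: "recf a \<Longrightarrow> recf (\<lambda>p n. neg (a p n))"
  unfolding neg_def by (intro rec_intros)

lemma code_len_le: "code_len c \<le> c"
proof -
  obtain w where "c = word_code w" using bij_word_code by (metis bij_pointE)
  then show ?thesis by (simp add: code_len_word_code length_le_word_code)
qed

text \<open>
  The number \<open>l\<close> stands for the literal \<open>S (l div 2, odd l)\<close>, a letter \<open>c\<close> for the conjunction of the
  finitely many literals in \<open>lits c\<close>. As \<open>lits\<close> ignores the second component of \<open>c\<close>, every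
  conjunction has arbitrarily large letters.
\<close>

locale compact_dyadic_space =
  fixes X :: "'a repspace" and S :: "nat \<times> bool \<Rightarrow> 'a set"
    and A :: "nat \<Rightarrow> nat \<Rightarrow> bool" and F :: "cantor \<Rightarrow> nat \<Rightarrow> nat option"
  assumes hausdorff: "Hausdorff_space (rep_topology X)"
    and generated: "rep_topology X = topology_generated_by (insert (points X) (range S))"
    and disjoint: "S (n, False) \<inter> S (n, True) = {}"
    and proper: "proper_subbase X S"
    and accepts_literal: "accepts X (A l) (S (l div 2, odd l))"
    and mono_A: "mono_acceptor (A l)"
    and rec_A: "recp (\<lambda>p n. A (pfst n) (psnd n))"
    and rec_F: "recursive_functional F"
    and F: "accepts X B U \<Longrightarrow>
      \<exists>q. computes_from F (assoc_of B) q \<and> ((\<exists>s. q s) \<longleftrightarrow> U = points X)"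
begin

definition lit :: "nat \<Rightarrow> 'a set" where
  "lit l = S (l div 2, odd l)"

definition open_of :: "nat set \<Rightarrow> 'a set" where
  "open_of T = {x \<in> points X. \<forall>l\<in>T. x \<in> lit l}"

definition closed_of :: "nat set \<Rightarrow> 'a set" where
  "closed_of T = {x \<in> points X. \<forall>l\<in>T. x \<notin> lit (neg l)}"

text \<open>Only a set without opposite literals corresponds to a finite sequence over Plotkin's
  space, and properness speaks only of such sequences.\<close>

definition consistent :: "nat set \<Rightarrow> bool" where
  "consistent T \<longleftrightarrow> \<not> (\<exists>l\<in>T. neg l \<in> T)"

section \<open>Literals and the sets they define\<close>

lemma lit_literal: "lit (2 * k + of_bool i) = S (k, i)"
  by (cases i) (simp_all add: lit_def)

lemma lit_subset: "lit l \<subseteq> points X"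
  using accepts_literal unfolding accepts_def lit_def by blast

lemma lit_disjoint: "x \<in> lit l \<Longrightarrow> x \<notin> lit (neg l)"
proof -
  obtain k i where l: "l = 2 * k + of_bool i" using literal_decode by blast
  show "x \<in> lit l \<Longrightarrow> x \<notin> lit (neg l)"
    using disjoint[of k] unfolding l neg_literal lit_literal by (cases i) auto
qed

lemma open_of_subset_closed_of: "open_of T \<subseteq> closed_of T"
  using lit_disjoint by (auto simp: open_of_def closed_of_def)

lemma open_of_antimono: "T \<subseteq> T' \<Longrightarrow> open_of T' \<subseteq> open_of T"
  by (auto simp: open_of_def)

lemma closed_of_antimono: "T \<subseteq> T' \<Longrightarrow> closed_of T' \<subseteq> closed_of T"
  by (auto simp: closed_of_def)

lemma open_of_inconsistent: "\<not> consistent T \<Longrightarrow> open_of T = {}"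
  using lit_disjoint by (auto simp: open_of_def consistent_def)

text \<open>By consistency \<open>T\<close> determines at most one value at each index, so it can be
  written as the finite sequence \<open>e\<close>, to which properness applies.\<close>

lemma closure_of_open_of:
  assumes "finite T" "consistent T"
  shows "rep_topology X closure_of open_of T = closed_of T"
proof -
  obtain N where N: "\<And>l. l \<in> T \<Longrightarrow> l < N"
    using assms(1) finite_nat_set_iff_bounded by auto
  define e where "e = map (\<lambda>k. if 2 * k + 1 \<in> T then Some True
      else if 2 * k \<in> T then Some False else None) [0..<N]"
  have c: "2 * k + 1 \<notin> T" if "2 * k \<in> T" for k
    using assms(2) that unfolding consistent_def by (auto simp: neg_def)
  have e: "pad_bot e k = Some i \<longleftrightarrow> 2 * k + of_bool i \<in> T" for k i
    using N[of "2 * k"] N[of "2 * k + 1"] c[of k] by (cases i) (auto simp: pad_bot_def e_def)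
  have all: "(\<forall>l\<in>T. P l) \<longleftrightarrow> (\<forall>k i. pad_bot e k = Some i \<longrightarrow> P (2 * k + of_bool i))" for P
    unfolding e by (metis literal_decode)
  have "subbase_open X S (pad_bot e) = open_of T"
    unfolding subbase_open_def open_of_def all lit_literal by (auto simp: dom_def)
  moreover have "subbase_closed X S (pad_bot e) = closed_of T"
    unfolding subbase_closed_def closed_of_def all neg_literal lit_literal by (auto simp: dom_def)
  ultimately show ?thesis using proper unfolding proper_subbase_def by metis
qed

lemma open_of_basis:
  assumes "openin (rep_topology X) U" "x \<in> U"
  shows "\<exists>T. finite T \<and> x \<in> open_of T \<and> open_of T \<subseteq> U"
proof -
  have "generate_topology_on (insert (points X) (range S)) U"
    using assms(1) unfolding generated openin_topology_generated_by_iff .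
  then show ?thesis using assms(2)
  proof induction
    case (Int a b)
    then obtain T T' where "finite T" "x \<in> open_of T" "open_of T \<subseteq> a"
      "finite T'" "x \<in> open_of T'" "open_of T' \<subseteq> b" by blast
    then show ?case by (intro exI[of _ "T \<union> T'"]) (auto simp: open_of_def)
  next
    case (UN K)
    from UN.prems obtain k where k: "k \<in> K" "x \<in> k" by (rule UnionE)
    from UN.IH[OF k] k(1) show ?case by (meson Union_upper order_trans)
  next
    case (Basis s)
    then consider "s = points X" | k i where "s = S (k, i)" by auto
    then show ?case
    proof cases
      case 1
      then show ?thesis using Basis by (intro exI[of _ "{}"]) (auto simp: open_of_def)
    next
      case 2
      then show ?thesis using Basis lit_subset[of "2 * k + of_bool i"]
        by (intro exI[of _ "{2 * k + of_bool i}"])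
          (auto simp: open_of_def lit_literal simp del: of_bool_eq_0_iff)
    qed
  qed simp
qed

lemma accepts_open_of: "finite T \<Longrightarrow> accepts X (\<lambda>u. \<forall>l\<in>T. A l u) (open_of T)"
  unfolding open_of_def lit_def by (intro accepts_Ball accepts_literal mono_A)

lemma openin_open_of: "finite T \<Longrightarrow> openin (rep_topology X) (open_of T)"
  using accepts_open_of accepts_imp_openin by blast

text \<open>\<open>F\<close> semidecides emptiness of the closed set whose complement is the union
  of the letters in \<open>L\<close>. The output position \<open>s\<close> is the witness that makes
  the relation decidable.\<close>

definition ver :: "nat \<Rightarrow> nat \<Rightarrow> bool" where
  "ver L s \<longleftrightarrow> F (assoc_of (\<lambda>u. \<exists>c\<in>set_decode L. \<forall>l\<in>lits c. A l u)) s = Some 1"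

lemma F_total:
  "F (assoc_of (\<lambda>u. \<exists>c\<in>set_decode L. \<forall>l\<in>lits c. A l u)) s = Some (of_bool (ver L s))"
  and ver_iff: "(\<exists>s. ver L s) \<longleftrightarrow> (\<Union>c\<in>set_decode L. open_of (lits c)) = points X"
proof -
  have "accepts X (\<lambda>u. \<exists>c\<in>set_decode L. \<forall>l\<in>lits c. A l u) (\<Union>c\<in>set_decode L. open_of (lits c))"
    by (intro accepts_Bex accepts_open_of finite_lits)
  from F[OF this] obtain q
    where q: "computes_from F (assoc_of (\<lambda>u. \<exists>c\<in>set_decode L. \<forall>l\<in>lits c. A l u)) q"
      "(\<exists>s. q s) \<longleftrightarrow> (\<Union>c\<in>set_decode L. open_of (lits c)) = points X" by blast
  have v: "ver L s = q s" for s using q(1) by (simp add: ver_def computes_from_def)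
  show "F (assoc_of (\<lambda>u. \<exists>c\<in>set_decode L. \<forall>l\<in>lits c. A l u)) s = Some (of_bool (ver L s))"
    using q(1) v by (simp add: computes_from_def)
  show "(\<exists>s. ver L s) \<longleftrightarrow> (\<Union>c\<in>set_decode L. open_of (lits c)) = points X"
    using v q(2) by simp
qed

text \<open>
  Whether \<open>F\<close> has recognised a cover is decided by a finite part of the name of the union, and that
  part mentions only finitely many members of the cover.
\<close>

lemma finite_subcover:
  assumes C: "points X \<subseteq> (\<Union>c\<in>C. open_of (lits c))"
  shows "\<exists>L. set_decode L \<subseteq> C \<and> (\<Union>c\<in>set_decode L. open_of (lits c)) = points X"
proof -
  \<comment> \<open>By monotonicity the bound \<open>c \<le> code_len u\<close> leaves the accepted
    set unchanged, but it makes the verdict on each prefix depend on finitely many letters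
    only.\<close>
  define B where "B D u \<longleftrightarrow> (\<exists>c\<in>D. c \<le> code_len u \<and> (\<forall>l\<in>lits c. A l u))" for D u
  have B: "accepts X (B D) (\<Union>c\<in>D. open_of (lits c))" for D
    unfolding B_def
  proof (rule accepts_Bex)
    fix c
    have m: "mono_acceptor (\<lambda>u. \<forall>l\<in>lits c. A l u)" by (intro mono_acceptor_Ball mono_A)
    have "(\<exists>k. \<forall>l\<in>lits c. A l (word_code (initial_segment q k))) \<longleftrightarrow>
        (\<exists>k. c \<le> k \<and> (\<forall>l\<in>lits c. A l (word_code (initial_segment q k))))" for q
      using m unfolding mono_acceptor_def by (meson max.cobounded1 max.cobounded2)
    then show "accepts X (\<lambda>u. c \<le> code_len u \<and> (\<forall>l\<in>lits c. A l u)) (open_of (lits c))"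
      using accepts_open_of[of "lits c"]
      unfolding accepts_def by (simp add: code_len_word_code)
  qed
  have "(\<Union>c\<in>C. open_of (lits c)) = points X" using C by (auto simp: open_of_def)
  moreover obtain q where q: "computes_from F (assoc_of (B C)) q"
      "(\<exists>s. q s) \<longleftrightarrow> (\<Union>c\<in>C. open_of (lits c)) = points X"
    using F[OF B[of C]] by (elim exE conjE)
  ultimately obtain s where "q s" by blast
  then have "F (assoc_of (B C)) s = Some 1" using q(1) by (simp add: computes_from_def)
  from recursive_functional_continuous[OF rec_F this]
  obtain N where N: "\<And>p. (\<forall>j<N. p j = assoc_of (B C) j) \<Longrightarrow> F p s = Some 1" by blast
  let ?D = "{c \<in> C. c \<le> N}"
  have "\<forall>j<N. assoc_of (B ?D) j = assoc_of (B C) j"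
  proof (intro allI impI)
    fix j assume "j < N"
    \<comment> \<open>Position \<open>j\<close> of the name concerns a prefix whose code, and hence
      length, is at most \<open>j\<close>; so letters above \<open>N\<close> cannot influence
      it.\<close>
    have "pfst (j div 2) \<le> j div 2" using le_prod_encode_1[of "pfst (j div 2)" "psnd (j div 2)"] by simp
    then have "code_len (pfst (j div 2)) \<le> N" using code_len_le[of "pfst (j div 2)"] \<open>j < N\<close> by linarith
    then have "B ?D (pfst (j div 2)) = B C (pfst (j div 2))" by (auto simp: B_def)
    then show "assoc_of (B ?D) j = assoc_of (B C) j" by (simp add: assoc_of_def)
  qed
  then have "F (assoc_of (B ?D)) s = Some 1" by (rule N)
  moreover obtain q where "computes_from F (assoc_of (B ?D)) q"
      "(\<exists>s. q s) \<longleftrightarrow> (\<Union>c\<in>?D. open_of (lits c)) = points X"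
    using F[OF B[of ?D]] by (elim exE conjE)
  ultimately have "(\<Union>c\<in>?D. open_of (lits c)) = points X"
    by (auto simp: computes_from_def)
  moreover have "finite ?D" by simp
  ultimately show ?thesis by (intro exI[of _ "set_encode ?D"]) auto
qed

text \<open>The conjunctions denoted by letters form a basis, so any open cover is first refined to
  a cover by letters and then thinned out by \<open>finite_subcover\<close>.\<close>

lemma compact_space_rep_topology: "compact_space (rep_topology X)"
  unfolding compact_space
proof (intro allI impI, elim conjE)
  fix K assume K: "\<forall>U\<in>K. openin (rep_topology X) U" "\<Union> K = topspace (rep_topology X)"
  let ?C = "{c. \<exists>U\<in>K. open_of (lits c) \<subseteq> U}"
  have "points X \<subseteq> (\<Union>c\<in>?C. open_of (lits c))"
  proof
    fix x assume "x \<in> points X"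
    then obtain U where U: "U \<in> K" "x \<in> U" using K(2) by (auto simp: topspace_rep_topology)
    then obtain T where "finite T" "x \<in> open_of T" "open_of T \<subseteq> U"
      using open_of_basis K(1) by meson
    then show "x \<in> (\<Union>c\<in>?C. open_of (lits c))"
      using U(1) lits_prod_encode[of T 0] by (intro UN_I[of "prod_encode (set_encode T, 0)"]) auto
  qed
  from finite_subcover[OF this] obtain L where
    L: "set_decode L \<subseteq> ?C" "(\<Union>c\<in>set_decode L. open_of (lits c)) = points X"
    by (elim exE conjE)
  from L(1) have "\<forall>c\<in>set_decode L. \<exists>U. U \<in> K \<and> open_of (lits c) \<subseteq> U" by blast
  from bchoice[OF this] obtain U
    where U: "\<And>c. c \<in> set_decode L \<Longrightarrow> U c \<in> K \<and> open_of (lits c) \<subseteq> U c" by blast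
  show "\<exists>G. finite G \<and> G \<subseteq> K \<and> \<Union> G = topspace (rep_topology X)"
  proof (intro exI[of _ "U ` set_decode L"] conjI)
    show "\<Union> (U ` set_decode L) = topspace (rep_topology X)"
    proof
      show "\<Union> (U ` set_decode L) \<subseteq> topspace (rep_topology X)" using U K(2) by blast
      show "topspace (rep_topology X) \<subseteq> \<Union> (U ` set_decode L)"
        unfolding topspace_rep_topology L(2)[symmetric] using U by blast
    qed
  qed (use U in auto)
qed

text \<open>Compact Hausdorff spaces are regular, so \<open>x\<close> has a closed neighbourhood
  inside \<open>W\<close>. A basic set in its interior that contains \<open>x\<close> is consistent,
  and by properness its closure is \<open>closed_of\<close>.\<close>

lemma regular_basis:
  assumes W: "openin (rep_topology X) W" and x: "x \<in> W"
  shows "\<exists>c. x \<in> open_of (lits c) \<and> closed_of (lits c) \<subseteq> W"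
proof -
  have "neighbourhood_base_of (closedin (rep_topology X)) (rep_topology X)"
    unfolding neighbourhood_base_of_closedin
    using compact_space_rep_topology hausdorff by (intro compact_Hausdorff_imp_regular_space) auto
  then obtain U V where UV: "openin (rep_topology X) U" "closedin (rep_topology X) V"
      "x \<in> U" "U \<subseteq> V" "V \<subseteq> W"
    using W x unfolding neighbourhood_base_of by meson
  obtain T where T: "finite T" "x \<in> open_of T" "open_of T \<subseteq> U"
    using open_of_basis UV(1,3) by blast
  then have "consistent T" using open_of_inconsistent by blast
  then have "closed_of T \<subseteq> V"
    using closure_of_open_of[OF T(1)] closure_of_minimal[OF _ UV(2)] T(3) UV(4) by blast
  then show ?thesis using T UV(5) lits_prod_encode[OF T(1), of 0]
    by (intro exI[of _ "prod_encode (set_encode T, 0)"]) auto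
qed

lemma openin_delete: "openin (rep_topology X) (points X - {x})"
proof (cases "x \<in> points X")
  case True
  then have "closedin (rep_topology X) {x}"
    using closedin_Hausdorff_singleton[OF hausdorff] by (simp add: topspace_rep_topology)
  then show ?thesis by (metis openin_closedin_eq closedin_def topspace_rep_topology)
next
  case False
  then show ?thesis using openin_topspace[of "rep_topology X"] by (simp add: topspace_rep_topology)
qed


subsection \<open>Words as sequences of distinct letters\<close>

text \<open>The index \<open>i\<close> codes a cover with its witness. Refinement is inclusion of
  literal sets: it is decidable and shrinks both \<open>open_of\<close> and
  \<open>closed_of\<close>.\<close>

definition small :: "nat \<Rightarrow> nat \<Rightarrow> bool" where
  "small t c \<longleftrightarrow> (\<forall>i<t. ver (pfst i) (psnd i) \<longrightarrow>
     (\<exists>d\<in>set_decode (pfst i). \<forall>l\<in>lits d. l \<in> lits c))"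

text \<open>The single bound \<open>M\<close> limits the cover and its witness, so each test is
  decidable. It also exceeds all letters of the cover, which thus lie from \<open>a\<close> up to
  below \<open>M\<close>.\<close>

definition next_cut :: "nat \<Rightarrow> nat \<Rightarrow> nat" where
  "next_cut n a = (LEAST M. a < M \<and>
     (\<exists>L\<le>M. \<exists>s\<le>M. ver L s \<and> (\<forall>c\<in>set_decode L. a \<le> c \<and> small n c)))"

definition cut :: "nat \<Rightarrow> nat" where
  "cut n = rec_nat 0 next_cut n"

definition flen :: "nat \<Rightarrow> nat" where
  "flen n = rec_nat 0 (\<lambda>k r. r + cut (Suc k)) n"

text \<open>The interval index \<open>t\<close> is determined by the letter, not by the block
  holding it; so a good letter may be reused in any later block. The bound \<open>t \<le> d\<close>
  loses nothing because \<open>t \<le> cut t \<le> d\<close>.\<close>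

definition good :: "nat \<Rightarrow> bool" where
  "good d \<longleftrightarrow> (\<exists>t\<le>d. cut t \<le> d \<and> d < cut (Suc t) \<and> small t d)"

text \<open>
  A word of length \<open>flen n\<close>, here given by its bits, consists of \<open>n\<close> blocks of lengths
  \<open>cut 1, \<dots>, cut n\<close>; in a valid word block \<open>k\<close> has a single \<open>1\<close>, at the position of its letter.
\<close>

definition letters :: "nat \<Rightarrow> (nat \<Rightarrow> bool) \<Rightarrow> nat set" where
  "letters n b = {d. \<exists>i<n. d < cut (Suc i) \<and> b (flen i + d)}"

definition valid :: "nat \<Rightarrow> (nat \<Rightarrow> bool) \<Rightarrow> bool" where
  "valid n b \<longleftrightarrow> (\<forall>k<n. \<exists>d<cut (Suc k). good d \<and> d \<notin> letters k b \<and>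
     (\<forall>e<cut (Suc k). b (flen k + e) \<longleftrightarrow> e = d))"

text \<open>Collecting the literals of one member containing \<open>x\<close> from each cover
  recognised so far gives a common refinement. The component ignored by \<open>lits\<close> is set
  to \<open>a\<close>, which pushes the code up to at least \<open>a\<close>.\<close>

lemma small_cover:
  assumes x: "x \<in> points X"
  shows "\<exists>c\<ge>a. small n c \<and> x \<in> open_of (lits c)"
proof -
  have "\<exists>d. d \<in> set_decode (pfst i) \<and> x \<in> open_of (lits d)" if "ver (pfst i) (psnd i)" for i
  proof -
    have "(\<Union>c\<in>set_decode (pfst i). open_of (lits c)) = points X" using ver_iff that by blast
    then show ?thesis using x by blast
  qed
  then obtain d where d: "\<And>i. ver (pfst i) (psnd i) \<Longrightarrow>
      d i \<in> set_decode (pfst i) \<and> x \<in> open_of (lits (d i))" by metis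
  let ?T = "\<Union>i\<in>{i. i < n \<and> ver (pfst i) (psnd i)}. lits (d i)"
  have T: "finite ?T" by auto
  have l: "lits (prod_encode (set_encode ?T, a)) = ?T" using lits_prod_encode[OF T] .
  have "small n (prod_encode (set_encode ?T, a))"
    unfolding small_def l using d by blast
  moreover have "x \<in> open_of ?T" using x d by (auto simp: open_of_def)
  ultimately show ?thesis
    using le_prod_encode_2 by (intro exI[of _ "prod_encode (set_encode ?T, a)"]) (simp add: l)
qed

lemma next_cut_exists:
  "\<exists>M. a < M \<and> (\<exists>L\<le>M. \<exists>s\<le>M. ver L s \<and> (\<forall>c\<in>set_decode L. a \<le> c \<and> small n c))"
proof -
  let ?C = "{c. a \<le> c \<and> small n c}"
  have "points X \<subseteq> (\<Union>c\<in>?C. open_of (lits c))" using small_cover by blast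
  from finite_subcover[OF this] obtain L where
    L: "set_decode L \<subseteq> ?C" "(\<Union>c\<in>set_decode L. open_of (lits c)) = points X"
    by (elim exE conjE)
  then obtain s where "ver L s" using ver_iff by blast
  then show ?thesis using L(1)
    by (intro exI[of _ "Suc (a + L + s)"] conjI exI[of _ L] exI[of _ s]) auto
qed

lemma cut_0 [simp]: "cut 0 = 0" and flen_0 [simp]: "flen 0 = 0"
  and flen_Suc [simp]: "flen (Suc n) = flen n + cut (Suc n)"
  by (simp_all add: cut_def flen_def)

lemma cut_Suc:
  "cut n < cut (Suc n) \<and> (\<exists>L\<le>cut (Suc n). \<exists>s\<le>cut (Suc n). ver L s \<and>
     (\<forall>c\<in>set_decode L. cut n \<le> c \<and> small n c))"
proof -
  have "cut (Suc n) = next_cut n (cut n)" by (simp add: cut_def)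
  then show ?thesis
    using LeastI_ex[OF next_cut_exists[of "cut n" n]] unfolding next_cut_def by simp
qed

lemma strict_mono_cut: "strict_mono cut"
  using cut_Suc by (simp add: strict_mono_Suc_iff)

lemma cut_mono: "m \<le> n \<Longrightarrow> cut m \<le> cut n"
  using strict_mono_cut by (simp add: strict_mono_less_eq)

lemma strict_mono_flen: "strict_mono flen"
  unfolding strict_mono_Suc_iff using cut_Suc by (metis add_0_right add_less_cancel_left flen_Suc gr_implies_not0 gr0I)

lemma flen_block_less: "i < n \<Longrightarrow> d < cut (Suc i) \<Longrightarrow> flen i + d < flen n"
  using strict_mono_flen[THEN strict_mono_less_eq, of "Suc i" n] by simp

lemma cut_cover:
  assumes x: "x \<in> points X"
  shows "\<exists>c. cut n \<le> c \<and> c < cut (Suc n) \<and> good c \<and> x \<in> open_of (lits c)"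
proof -
  obtain L s where L: "L \<le> cut (Suc n)" "ver L s" "\<forall>c\<in>set_decode L. cut n \<le> c \<and> small n c"
    using cut_Suc[of n] by blast
  then obtain c where c: "c \<in> set_decode L" "x \<in> open_of (lits c)" using ver_iff x by blast
  then have "cut n \<le> c" "c < cut (Suc n)" "small n c"
    using L mem_set_decode_less[OF c(1)] by auto
  moreover have "n \<le> c" using \<open>cut n \<le> c\<close> strict_mono_imp_increasing[OF strict_mono_cut, of n] by linarith
  ultimately show ?thesis using c(2) unfolding good_def by blast
qed

text \<open>Bits are read by \<open>(!)\<close> or by \<open>code_bit\<close>, which are known to
  agree only within the word. The same rule lets a word be replaced by its prefix.\<close>

lemma letters_cong:
  assumes "\<And>j. j < flen n \<Longrightarrow> b j = b' j"
  shows "letters n b = letters n b'"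
  using assms flen_block_less unfolding letters_def by blast

lemma valid_cong:
  assumes b: "\<And>j. j < flen n \<Longrightarrow> b j = b' j"
  shows "valid n b = valid n b'"
proof -
  have "letters k b = letters k b'" if "k < n" for k
    using b strict_mono_flen that by (intro letters_cong) (meson less_trans strict_mono_less)
  then show ?thesis unfolding valid_def using b flen_block_less by (simp cong: conj_cong)
qed

section \<open>Letters of valid words and their number\<close>

lemma letters_0 [simp]: "letters 0 b = {}" and valid_0 [simp]: "valid 0 b"
  by (simp_all add: letters_def valid_def)

lemma letters_Suc: "letters (Suc n) b = letters n b \<union> {d. d < cut (Suc n) \<and> b (flen n + d)}"
  by (auto simp: letters_def less_Suc_eq)

lemma valid_SucE:
  assumes "valid (Suc n) b"
  obtains d where "valid n b" "d < cut (Suc n)" "good d" "d \<notin> letters n b"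
    "letters (Suc n) b = insert d (letters n b)"
proof -
  from assms obtain d where d: "d < cut (Suc n)" "good d" "d \<notin> letters n b"
    "\<forall>e<cut (Suc n). b (flen n + e) \<longleftrightarrow> e = d" unfolding valid_def by blast
  moreover have "valid n b" using assms by (simp add: valid_def)
  moreover have "letters (Suc n) b = insert d (letters n b)" using d by (auto simp: letters_Suc)
  ultimately show ?thesis using that by blast
qed

lemma letters_less_cut: "d \<in> letters n b \<Longrightarrow> d < cut n"
proof -
  assume "d \<in> letters n b"
  then obtain i where "i < n" "d < cut (Suc i)" by (auto simp: letters_def)
  then show ?thesis using cut_mono[of "Suc i" n] by simp
qed

lemma finite_letters [simp]: "finite (letters n b)"
  using letters_less_cut by (intro finite_subset[of "letters n b" "{..<cut n}"]) auto

lemma card_letters: "valid n b \<Longrightarrow> card (letters n b) = n"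
  by (induction n) (auto elim!: valid_SucE)

lemma valid_good: "valid n b \<Longrightarrow> d \<in> letters n b \<Longrightarrow> good d"
  by (induction n) (auto elim!: valid_SucE)

text \<open>
  There are only \<open>cut t\<close> letters below \<open>cut t\<close>, so a valid word with more than \<open>cut t\<close> letters has a
  letter which refines all covers recognised before stage \<open>t\<close>.
\<close>

lemma valid_refines_cover:
  assumes C: "points X \<subseteq> (\<Union>c\<in>C. open_of (lits c))"
  shows "\<exists>n. \<forall>b. valid n b \<longrightarrow> (\<exists>c\<in>letters n b. \<exists>d\<in>C. lits d \<subseteq> lits c)"
proof -
  obtain L where L: "set_decode L \<subseteq> C" "(\<Union>c\<in>set_decode L. open_of (lits c)) = points X"
    using finite_subcover[OF C] by blast
  then obtain s where s: "ver L s" using ver_iff by blast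
  \<comment> \<open>This is the first stage at which \<open>small\<close> takes the pair of
    \<open>L\<close> and \<open>s\<close> into account.\<close>
  define t where "t = Suc (prod_encode (L, s))"
  show ?thesis
  proof (intro exI[of _ "Suc (cut t)"] allI impI)
    fix b assume v: "valid (Suc (cut t)) b"
    have "\<not> letters (Suc (cut t)) b \<subseteq> {..<cut t}"
      using card_mono[of "{..<cut t}" "letters (Suc (cut t)) b"] card_letters[OF v] by auto
    then obtain c where c: "c \<in> letters (Suc (cut t)) b" "cut t \<le> c" by (meson lessThan_iff not_less subsetI)
    obtain t' where t': "c < cut (Suc t')" "small t' c"
      using valid_good[OF v c(1)] by (auto simp: good_def)
    have "t \<le> t'" using c(2) t'(1) cut_mono[of "Suc t'" t] by (metis not_less_eq_eq leD le_trans)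
    then have "prod_encode (L, s) < t'" by (simp add: t_def)
    then obtain d where "d \<in> set_decode L" "lits d \<subseteq> lits c"
      using t'(2) s unfolding small_def by (metis fst_conv prod_encode_inverse snd_conv subsetI)
    then show "\<exists>c\<in>letters (Suc (cut t)) b. \<exists>d\<in>C. lits d \<subseteq> lits c" using c(1) L(1) by blast
  qed
qed

lemma valid_extend:
  assumes w: "length w = flen n" "valid n ((!) w)"
    and d: "good d" "d < cut (Suc n)" "d \<notin> letters n ((!) w)"
  shows "\<exists>v. length v = flen (Suc n) \<and> prefix w v \<and> valid (Suc n) ((!) v) \<and>
    letters (Suc n) ((!) v) = insert d (letters n ((!) w))"
proof -
  let ?v = "w @ map (\<lambda>j. j = d) [0..<cut (Suc n)]"
  have low: "?v ! j = w ! j" if "j < flen n" for j using that w by (simp add: nth_append)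
  have high: "?v ! (flen n + e) \<longleftrightarrow> e = d" if "e < cut (Suc n)" for e
    using that w by (simp add: nth_append)
  have l: "letters n ((!) ?v) = letters n ((!) w)" by (rule letters_cong[OF low])
  have "valid n ((!) ?v)" using valid_cong[OF low] w(2) by simp
  then have "valid (Suc n) ((!) ?v)"
    using d high l unfolding valid_def by (auto simp: less_Suc_eq)
  moreover have "letters (Suc n) ((!) ?v) = insert d (letters n ((!) w))"
    using d(2) high l by (auto simp: letters_Suc)
  moreover have "length ?v = flen (Suc n)" using w by simp
  moreover have "prefix w ?v" by simp
  ultimately show ?thesis by blast
qed

text \<open>The letters of \<open>b\<close> missing from \<open>w\<close> are appended one block at
  a time. This combinatorial fact carries the intersection property and holds whether or not the
  sets meet.\<close>

lemma valid_join:
  assumes w: "length w = flen n" "valid n ((!) w)"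
  shows "valid m b \<Longrightarrow> \<exists>k u. length u = flen k \<and> prefix w u \<and> valid k ((!) u) \<and>
    letters k ((!) u) = letters n ((!) w) \<union> letters m b"
proof (induction m)
  case 0
  then show ?case using w by (intro exI[of _ n] exI[of _ w]) simp
next
  case (Suc m)
  from Suc.prems obtain d where d: "valid m b" "d < cut (Suc m)" "good d"
    "letters (Suc m) b = insert d (letters m b)" by (rule valid_SucE)
  from Suc.IH[OF d(1)] obtain k u where u: "length u = flen k" "prefix w u" "valid k ((!) u)"
    "letters k ((!) u) = letters n ((!) w) \<union> letters m b" by blast
  show ?case
  proof (cases "d \<in> letters k ((!) u)")
    case True
    then show ?thesis using u d(4) by (intro exI[of _ k] exI[of _ u]) auto
  next
    case False
    \<comment> \<open>The word \<open>u\<close> already contains the \<open>m\<close> distinct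
      letters of \<open>b\<close>, so it has at least \<open>m\<close> blocks and its next block is
      long enough for \<open>d\<close>.\<close>
    have "m \<le> k"
      using card_mono[of "letters k ((!) u)" "letters m b"] card_letters[OF d(1)]
        card_letters[OF u(3)] u(4) by simp
    then have "d < cut (Suc k)" using d(2) cut_mono[of "Suc m" "Suc k"] by simp
    from valid_extend[OF u(1,3) d(3) this False] obtain v where
      "length v = flen (Suc k)" "prefix u v" "valid (Suc k) ((!) v)"
      "letters (Suc k) ((!) v) = insert d (letters k ((!) u))" by blast
    then show ?thesis using u d(4)
      by (intro exI[of _ "Suc k"] exI[of _ v]) (auto intro: prefix_order.trans)
  qed
qed

subsection \<open>The sets indexed by words\<close>

text \<open>The inequality makes the search succeed on every code; \<open>ok\<close> then rejects
  lengths that are not values of \<open>flen\<close>.\<close>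

definition level :: "nat \<Rightarrow> nat" where
  "level c = (LEAST n. code_len c \<le> flen n)"

definition ok :: "nat \<Rightarrow> bool" where
  "ok c \<longleftrightarrow> flen (level c) = code_len c \<and> valid (level c) (code_bit c)"

definition lett :: "nat \<Rightarrow> nat set" where
  "lett c = letters (level c) (code_bit c)"

definition wlits :: "nat \<Rightarrow> nat set" where
  "wlits c = (\<Union>d\<in>lett c. lits d)"

definition R :: "bool list \<Rightarrow> 'a set" where
  "R w = (if ok (word_code w) then open_of (wlits (word_code w)) else {})"

text \<open>With opposite literals \<open>open_of\<close> is empty while \<open>closed_of\<close>
  may contain points outside both of them, hence the explicit and decidable consistency
  test.\<close>

definition R' :: "bool list \<Rightarrow> 'a set" where
  "R' w = (if ok (word_code w) \<and> consistent (wlits (word_code w))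
     then closed_of (wlits (word_code w)) else {})"

lemma finite_wlits [simp]: "finite (wlits c)"
  by (simp add: wlits_def lett_def)

lemma level_word_code: "length w = flen n \<Longrightarrow> level (word_code w) = n"
  unfolding level_def code_len_word_code
  using strict_mono_flen by (intro Least_equality) (simp_all add: strict_mono_less_eq)

lemma ok_word_code: "length w = flen n \<Longrightarrow> ok (word_code w) \<longleftrightarrow> valid n ((!) w)"
  unfolding ok_def by (simp add: level_word_code code_len_word_code)
    (rule valid_cong, simp add: code_bit_word_code)

lemma lett_word_code: "length w = flen n \<Longrightarrow> lett (word_code w) = letters n ((!) w)"
  unfolding lett_def by (simp add: level_word_code)
    (rule letters_cong, simp add: code_bit_word_code)

section \<open>Coverings, closures and refinement for the sets \<open>R w\<close>\<close>

lemma R_Nil: "R [] = points X"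
  by (simp add: R_def ok_word_code[of "[]" 0, simplified] lett_word_code[of "[]" 0, simplified]
      wlits_def open_of_def)

lemma R_mem_iff:
  assumes "length w = flen n"
  shows "x \<in> R w \<longleftrightarrow> valid n ((!) w) \<and> x \<in> points X \<and> (\<forall>d\<in>letters n ((!) w). x \<in> open_of (lits d))"
  using ok_word_code[OF assms] lett_word_code[OF assms]
  by (auto simp: R_def wlits_def open_of_def)

text \<open>The letters of \<open>w\<close> lie below \<open>cut n\<close>, while those from
  \<open>cut n\<close> to below \<open>cut (Suc n)\<close> cover the space; so a new letter
  containing \<open>x\<close> is available.\<close>

lemma R_extend:
  assumes w: "length w = flen n" and x: "x \<in> R w"
  shows "\<exists>v. length v = flen (Suc n) \<and> prefix w v \<and> x \<in> R v"
proof -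
  have v: "valid n ((!) w)" and "x \<in> points X"
    and l: "\<forall>d\<in>letters n ((!) w). x \<in> open_of (lits d)"
    using x R_mem_iff[OF w] by auto
  from cut_cover[OF \<open>x \<in> points X\<close>] obtain c where
    c: "cut n \<le> c" "c < cut (Suc n)" "good c" "x \<in> open_of (lits c)" by blast
  then have "c \<notin> letters n ((!) w)" using letters_less_cut by fastforce
  from valid_extend[OF w v c(3,2) this] obtain u where
    u: "length u = flen (Suc n)" "prefix w u" "valid (Suc n) ((!) u)"
      "letters (Suc n) ((!) u) = insert c (letters n ((!) w))" by blast
  then have "x \<in> R u" using R_mem_iff[OF u(1)] \<open>x \<in> points X\<close> c(4) l by simp
  then show ?thesis using u by blast
qed

lemma R_antimono:
  assumes w: "length w = flen n" and v: "length v = flen (Suc n)" and p: "prefix w v"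
  shows "R v \<subseteq> R w"
proof
  fix x assume x: "x \<in> R v"
  have low: "v ! j = w ! j" if "j < flen n" for j
    using p that w by (auto simp: prefix_def nth_append)
  from x have "valid (Suc n) ((!) v)" using R_mem_iff[OF v] by blast
  then have "valid n ((!) v)" "letters n ((!) v) \<subseteq> letters (Suc n) ((!) v)"
    by (auto elim!: valid_SucE)
  then have "valid n ((!) w)" "letters n ((!) w) \<subseteq> letters (Suc n) ((!) v)"
    using valid_cong[of n "(!) v", OF low] letters_cong[of n "(!) v", OF low] by auto
  then show "x \<in> R w" using x R_mem_iff[OF v] R_mem_iff[OF w] by auto
qed

lemma R_Union:
  assumes "w \<in> words_of_length (flen n)"
  shows "R w = (\<Union>v \<in> {v \<in> words_of_length (flen (n + 1)). prefix w v}. R v)"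
  using assms R_extend[of w n] R_antimono[of w n] unfolding words_of_length_def
  by (auto simp del: flen_Suc)

lemma closure_of_R: "rep_topology X closure_of R w = R' w"
  unfolding R_def R'_def using closure_of_open_of[OF finite_wlits] open_of_inconsistent
  by (auto simp: closure_of_empty)

lemma R_covers_point:
  assumes "x \<in> points X"
  shows "\<exists>w. length w = flen n \<and> x \<in> R w"
proof (induction n)
  case 0
  then show ?case using assms R_Nil by auto
next
  case (Suc n)
  then show ?case using R_extend by blast
qed

lemma R'_subset: "length w = flen n \<Longrightarrow> d \<in> letters n ((!) w) \<Longrightarrow> R' w \<subseteq> closed_of (lits d)"
  using lett_word_code[of w n] by (auto simp: R'_def wlits_def closed_of_def)

text \<open>Refine the cover by letters whose closed set lies in \<open>U\<close> or misses
  \<open>x\<close>. If \<open>x \<in> R w\<close>, the member refined by a letter of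
  \<open>w\<close> contains \<open>x\<close>, so only the first alternative remains.\<close>

lemma R_basis:
  assumes U: "openin (rep_topology X) U" and x: "x \<in> U"
  shows "\<exists>w\<in>words flen. x \<in> R w \<and> R' w \<subseteq> U"
proof -
  let ?C = "{d. closed_of (lits d) \<subseteq> U \<or> x \<notin> closed_of (lits d)}"
  have "U \<subseteq> points X" using openin_subset[OF U] by (simp add: topspace_rep_topology)
  have "points X \<subseteq> (\<Union>c\<in>?C. open_of (lits c))"
  proof
    fix z assume z: "z \<in> points X"
    show "z \<in> (\<Union>c\<in>?C. open_of (lits c))"
    proof (cases "z = x")
      case True
      then show ?thesis using regular_basis[OF U] x by blast
    next
      case False
      then show ?thesis using regular_basis[OF openin_delete, of z x] z by blast
    qed
  qed
  from valid_refines_cover[OF this] obtain n where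
    n: "\<And>b. valid n b \<Longrightarrow> \<exists>c\<in>letters n b. \<exists>d\<in>?C. lits d \<subseteq> lits c"
    by blast
  obtain w where w: "length w = flen n" "x \<in> R w"
    using R_covers_point x \<open>U \<subseteq> points X\<close> by blast
  then obtain c d where c: "c \<in> letters n ((!) w)" "d \<in> ?C" "lits d \<subseteq> lits c"
    using n R_mem_iff[OF w(1)] by blast
  have "x \<in> open_of (lits c)" using c(1) w R_mem_iff by blast
  then have "x \<in> closed_of (lits d)"
    using open_of_antimono[OF c(3)] open_of_subset_closed_of by blast
  then have "closed_of (lits d) \<subseteq> U" using c(2) by blast
  then have "R' w \<subseteq> U" using R'_subset[OF w(1) c(1)] closed_of_antimono[OF c(3)] by blast
  moreover have "w \<in> words flen" using w(1) by (auto simp: words_def words_of_length_def)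
  ultimately show ?thesis using w(2) by blast
qed

text \<open>Refine the cover by letters whose closed sets do not contain both points. This makes the
  premise of the separation property false at level \<open>n\<close>.\<close>

lemma R'_separates:
  assumes "x \<noteq> y"
  shows "\<exists>n. \<forall>w\<in>words_of_length (flen n). \<not> (x \<in> R' w \<and> y \<in> R' w)"
proof -
  let ?C = "{d. \<not> (x \<in> closed_of (lits d) \<and> y \<in> closed_of (lits d))}"
  have "points X \<subseteq> (\<Union>c\<in>?C. open_of (lits c))"
  proof
    fix z assume z: "z \<in> points X"
    show "z \<in> (\<Union>c\<in>?C. open_of (lits c))"
    proof (cases "z = x")
      case True
      then show ?thesis using regular_basis[OF openin_delete, of z y] z assms by blast
    next
      case False
      then show ?thesis using regular_basis[OF openin_delete, of z x] z by blast
    qed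
  qed
  from valid_refines_cover[OF this] obtain n where
    n: "\<And>b. valid n b \<Longrightarrow> \<exists>c\<in>letters n b. \<exists>d\<in>?C. lits d \<subseteq> lits c"
    by blast
  have "\<not> (x \<in> R' w \<and> y \<in> R' w)" if w: "length w = flen n" for w
  proof
    assume xy: "x \<in> R' w \<and> y \<in> R' w"
    then have "ok (word_code w)" unfolding R'_def by (auto split: if_splits)
    then obtain c d where "c \<in> letters n ((!) w)" "d \<in> ?C" "lits d \<subseteq> lits c"
      using n ok_word_code[OF w] by blast
    then show False using xy R'_subset[OF w] closed_of_antimono by blast
  qed
  then show ?thesis unfolding words_of_length_def by blast
qed

lemma openin_R: "openin (rep_topology X) (R w)"
  unfolding R_def by (auto intro: openin_open_of)

end


section \<open>Computability of the construction\<close>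

lemma recp_mem_lits [rec_intros]: "recf a \<Longrightarrow> recf b \<Longrightarrow> recp (\<lambda>p n. a p n \<in> lits (b p n))"
  unfolding lits_def by (intro rec_intros)

lemma recp_bex_lits [rec_intros]:
  assumes "recf b" and "recp (\<lambda>p x. P p (pfst x) (psnd x))"
  shows "recp (\<lambda>p n. \<exists>k\<in>lits (b p n). P p n k)"
  unfolding lits_def by (intro rec_intros assms)

lemma recp_ball_lits [rec_intros]:
  assumes "recf b" and "recp (\<lambda>p x. P p (pfst x) (psnd x))"
  shows "recp (\<lambda>p n. \<forall>k\<in>lits (b p n). P p n k)"
  unfolding lits_def by (intro rec_intros assms)

context compact_dyadic_space
begin

lemma recp_A [rec_intros]: "recf a \<Longrightarrow> recf b \<Longrightarrow> recp (\<lambda>p n. A (a p n) (b p n))"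
  using rec_A by (rule recp_comp2)

text \<open>\<open>F\<close> may be partial, but it is total on these names by
  \<open>F_total\<close>, so oracle substitution yields a total decidable relation.\<close>

lemma recp_ver [rec_intros]: "recf a \<Longrightarrow> recf b \<Longrightarrow> recp (\<lambda>p n. ver (a p n) (b p n))"
proof (rule recp_comp2[where P = "\<lambda>p. ver"])
  have "recp (\<lambda>p x. assoc_of (\<lambda>u. \<exists>c\<in>set_decode (pfst x). \<forall>l\<in>lits c. A l u) (psnd x))"
    by (intro rec_intros)
  from recursive_functional_subst[OF rec_F this]
  show "recp (\<lambda>p x. ver (pfst x) (psnd x))"
    by (simp add: F_total recp_def recf_def)
qed

section \<open>Decidability of cuts, validity and letters\<close>

lemma recp_small [rec_intros]: "recf a \<Longrightarrow> recf b \<Longrightarrow> recp (\<lambda>p n. small (a p n) (b p n))"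
  by (rule recp_comp2[where P = "\<lambda>p. small"]) (unfold small_def, intro rec_intros)

lemma recf_next_cut [rec_intros]: "recf a \<Longrightarrow> recf b \<Longrightarrow> recf (\<lambda>p n. next_cut (a p n) (b p n))"
proof (rule recf_comp2[where g = "\<lambda>p. next_cut"])
  show "recf (\<lambda>p x. next_cut (pfst x) (psnd x))"
    unfolding next_cut_def by (rule recf_Least[OF _ next_cut_exists]) (intro rec_intros)
qed

lemma recf_cut [rec_intros]: "recf a \<Longrightarrow> recf (\<lambda>p n. cut (a p n))"
  unfolding cut_def by (intro rec_intros)

lemma recf_flen [rec_intros]: "recf a \<Longrightarrow> recf (\<lambda>p n. flen (a p n))"
  unfolding flen_def by (intro rec_intros)

lemma recp_good [rec_intros]: "recf a \<Longrightarrow> recp (\<lambda>p n. good (a p n))"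
  by (rule recp_comp[where P = "\<lambda>p. good"]) (unfold good_def, intro rec_intros)

lemma recf_level [rec_intros]: "recf a \<Longrightarrow> recf (\<lambda>p n. level (a p n))"
proof (rule recf_comp[where f = "\<lambda>p. level"])
  show "recf (\<lambda>p. level)"
    unfolding level_def
  proof (rule recf_Least)
    show "\<exists>n. code_len c \<le> flen n" for c
      using strict_mono_imp_increasing[OF strict_mono_flen] by blast
  qed (intro rec_intros)
qed

lemma recp_bex_letters [rec_intros]:
  assumes k: "recf k" and c: "recf c" and P: "recp (\<lambda>p x. P p (pfst x) (psnd x))"
  shows "recp (\<lambda>p n. \<exists>d\<in>letters (k p n) (code_bit (c p n)). P p n d)"
proof -
  have "(\<exists>d\<in>letters m b. Q d) \<longleftrightarrow> (\<exists>i<m. \<exists>d<cut (Suc i). b (flen i + d) \<and> Q d)" for m b Q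
    unfolding letters_def by blast
  moreover have "recp (\<lambda>p n. \<exists>i<k p n. \<exists>d<cut (Suc i). code_bit (c p n) (flen i + d) \<and> P p n d)"
    by (intro rec_intros k recf_comp[OF c] recp_comp2[OF P])
  ultimately show ?thesis by simp
qed

lemma recp_valid [rec_intros]:
  "recf a \<Longrightarrow> recf b \<Longrightarrow> recp (\<lambda>p n. valid (a p n) (code_bit (b p n)))"
proof (rule recp_comp2[where P = "\<lambda>p n c. valid n (code_bit c)"])
  have m: "d \<notin> letters m b \<longleftrightarrow> \<not> (\<exists>e\<in>letters m b. e = d)" for d m b by blast
  show "recp (\<lambda>p x. valid (pfst x) (code_bit (psnd x)))"
    unfolding valid_def m by (intro rec_intros)
qed

lemma recp_ok [rec_intros]: "recf a \<Longrightarrow> recp (\<lambda>p n. ok (a p n))"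
  unfolding ok_def by (intro rec_intros)

lemma recp_bex_lett [rec_intros]:
  assumes c: "recf c" and P: "recp (\<lambda>p x. P p (pfst x) (psnd x))"
  shows "recp (\<lambda>p n. \<exists>d\<in>lett (c p n). P p n d)"
  unfolding lett_def by (intro rec_intros assms)

lemma recp_ball_lett [rec_intros]:
  assumes "recf c" and "recp (\<lambda>p x. P p (pfst x) (psnd x))"
  shows "recp (\<lambda>p n. \<forall>d\<in>lett (c p n). P p n d)"
proof -
  have "recp (\<lambda>p n. \<not> (\<exists>d\<in>lett (c p n). \<not> P p n d))"
    using assms by (intro rec_intros)
  then show ?thesis by simp
qed

lemma recp_mem_lett [rec_intros]:
  assumes "recf d" and "recf c"
  shows "recp (\<lambda>p n. d p n \<in> lett (c p n))"
proof -
  have "recp (\<lambda>p n. \<exists>e\<in>lett (c p n). e = d p n)"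
    by (intro rec_intros assms recf_comp[OF assms(1)])
  then show ?thesis by simp
qed

definition R_acc :: "nat \<Rightarrow> nat \<Rightarrow> bool" where
  "R_acc c u \<longleftrightarrow> ok c \<and> (\<forall>d\<in>lett c. \<forall>l\<in>lits d. A l u)"

text \<open>This accepts the complement of \<open>R'\<close>: everything if that set is declared
  empty, otherwise the union of the opposite literals. \<open>wlits\<close> is replaced by nested
  quantifiers, for which closure rules exist.\<close>

definition R'_acc :: "nat \<Rightarrow> nat \<Rightarrow> bool" where
  "R'_acc c u \<longleftrightarrow> \<not> (ok c \<and> \<not> (\<exists>d\<in>lett c. \<exists>l\<in>lits d. \<exists>e\<in>lett c. neg l \<in> lits e)) \<or>
     (\<exists>d\<in>lett c. \<exists>l\<in>lits d. A (neg l) u)"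

lemma recp_R_acc [rec_intros]: "recf a \<Longrightarrow> recf b \<Longrightarrow> recp (\<lambda>p n. R_acc (a p n) (b p n))"
  by (rule recp_comp2[where P = "\<lambda>p. R_acc"]) (unfold R_acc_def, intro rec_intros)

lemma recp_R'_acc [rec_intros]: "recf a \<Longrightarrow> recf b \<Longrightarrow> recp (\<lambda>p n. R'_acc (a p n) (b p n))"
  by (rule recp_comp2[where P = "\<lambda>p. R'_acc"]) (unfold R'_acc_def, intro rec_intros)

lemma accepts_R: "accepts X (R_acc (word_code w)) (R w)"
proof -
  have "R_acc (word_code w) = (\<lambda>u. ok (word_code w) \<and> (\<forall>l\<in>wlits (word_code w). A l u))"
    by (auto simp: fun_eq_iff R_acc_def wlits_def)
  then show ?thesis
    unfolding R_def by (simp only: accepts_conj_const accepts_open_of finite_wlits)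
qed

lemma accepts_R': "accepts X (R'_acc (word_code w)) (points X - R' w)"
proof -
  let ?T = "wlits (word_code w)" and ?b = "\<not> (ok (word_code w) \<and> consistent (wlits (word_code w)))"
  have "R'_acc (word_code w) = (\<lambda>u. ?b \<or> (\<exists>l\<in>?T. A (neg l) u))"
    by (auto simp: fun_eq_iff R'_acc_def wlits_def consistent_def)
  moreover have "accepts X (\<lambda>u. \<exists>l\<in>?T. A (neg l) u) (\<Union>l\<in>?T. lit (neg l))"
    using accepts_literal unfolding lit_def by (intro accepts_Bex)
  moreover have "points X - R' w = (if ?b then points X else (\<Union>l\<in>?T. lit (neg l)))"
    using lit_subset by (auto simp: R'_def closed_of_def)
  ultimately show ?thesis by (simp only: accepts_disj_const)
qed

definition code_prefix :: "nat \<Rightarrow> nat \<Rightarrow> bool" where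
  "code_prefix c c' \<longleftrightarrow> code_len c \<le> code_len c' \<and> code_take (code_len c) c' = c"

lemma code_prefix_word_code: "code_prefix (word_code w) (word_code v) \<longleftrightarrow> prefix w v"
proof -
  have "prefix w v \<longleftrightarrow> length w \<le> length v \<and> take (length w) v = w"
    by (metis append_eq_conv_conj prefix_def prefix_length_le append_take_drop_id)
  then show ?thesis
    using bij_word_code
    by (auto simp: code_prefix_def code_len_word_code code_take_word_code bij_def inj_eq)
qed

definition join_spec :: "nat \<Rightarrow> nat \<Rightarrow> nat \<Rightarrow> bool" where
  "join_spec c c' u \<longleftrightarrow> ok u \<and> code_prefix c u \<and> (\<forall>d\<in>lett u. d \<in> lett c \<or> d \<in> lett c') \<and>
     (\<forall>d\<in>lett c. d \<in> lett u) \<and> (\<forall>d\<in>lett c'. d \<in> lett u)"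

text \<open>The premise makes the search total: if one of the words is not valid, it stops at
  0.\<close>

definition join :: "nat \<Rightarrow> nat \<Rightarrow> nat" where
  "join c c' = (LEAST u. ok c \<and> ok c' \<longrightarrow> join_spec c c' u)"

lemma join_exists: "\<exists>u. ok c \<and> ok c' \<longrightarrow> join_spec c c' u"
proof (cases "ok c \<and> ok c'")
  case True
  obtain w where w: "c = word_code w" using bij_word_code by (metis bij_pointE)
  from True have l: "length w = flen (level c)" and v: "valid (level c) ((!) w)"
    using ok_word_code[of w "level c"] by (auto simp: w ok_def code_len_word_code)
  from valid_join[OF l v] True obtain k u where u: "length u = flen k" "prefix w u" "valid k ((!) u)"
    "letters k ((!) u) = letters (level c) ((!) w) \<union> lett c'" unfolding ok_def lett_def by blast
  then have "join_spec c c' (word_code u)"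
    using ok_word_code[OF u(1)] lett_word_code[OF u(1)] lett_word_code[OF l]
    by (auto simp: join_spec_def w code_prefix_word_code)
  then show ?thesis by blast
qed blast

lemma join_spec_join: "ok c \<Longrightarrow> ok c' \<Longrightarrow> join_spec c c' (join c c')"
  using LeastI_ex[OF join_exists[of c c']] by (simp add: join_def)

lemma recf_join [rec_intros]: "recf a \<Longrightarrow> recf b \<Longrightarrow> recf (\<lambda>p n. join (a p n) (b p n))"
proof (rule recf_comp2[where g = "\<lambda>p. join"])
  show "recf (\<lambda>p x. join (pfst x) (psnd x))"
    unfolding join_def
  proof (rule recf_Least[OF _ join_exists])
    show "recp (\<lambda>p x. ok (pfst (pfst x)) \<and> ok (psnd (pfst x)) \<longrightarrow>
        join_spec (pfst (pfst x)) (psnd (pfst x)) (psnd x))"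
      unfolding join_spec_def code_prefix_def by (intro rec_intros)
  qed
qed

lemma mem_words_flen_iff: "flen (level (word_code w)) = code_len (word_code w) \<longleftrightarrow> w \<in> words flen"
proof
  assume "flen (level (word_code w)) = code_len (word_code w)"
  then have "length w = flen (level (word_code w))" by (simp add: code_len_word_code)
  then show "w \<in> words flen" unfolding words_def words_of_length_def by blast
qed (auto simp: words_def words_of_length_def level_word_code code_len_word_code)

lemma join_word:
  assumes "ok (word_code w)" "ok (word_code v)" "join (word_code w) (word_code v) = word_code u"
  shows "u \<in> words flen \<and> prefix w u \<and> R w \<inter> R v = R u"
proof -
  have j: "join_spec (word_code w) (word_code v) (word_code u)"
    using join_spec_join[OF assms(1,2)] assms(3) by simp
  then have "ok (word_code u)" "prefix w u" by (auto simp: join_spec_def code_prefix_word_code)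
  moreover have "lett (word_code u) = lett (word_code w) \<union> lett (word_code v)"
    using j by (auto simp: join_spec_def)
  moreover have "u \<in> words flen"
    using \<open>ok (word_code u)\<close> mem_words_flen_iff by (simp add: ok_def)
  ultimately show ?thesis
    using assms by (auto simp: R_def wlits_def open_of_def)
qed

end


section \<open>Realizers\<close>

lemma Least_singleton [simp]: "(LEAST k. k = (n::nat)) = n"
  by (rule Least_equality) simp_all

lemma nat_rep_singleton: "nat_rep (\<lambda>k. k = n) = Some n"
  by (simp add: nat_rep_def)

lemma word_code_inv [simp]: "word_code (inv word_code c) = c" "inv word_code (word_code w) = w"
  using bij_word_code by (simp_all add: bij_is_surj surj_f_inv_f bij_is_inj)

lemma words_rep_eq_Some_iff:
  "words_rep f p = Some w \<longleftrightarrow> w \<in> words f \<and> (\<exists>k. p k) \<and> (LEAST k. p k) = word_code w"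
  unfolding words_rep_def sub_rep_def word_rep_def nat_rep_def
  by (auto simp: bind_eq_Some_conv)

lemma words_rep_singleton: "w \<in> words f \<Longrightarrow> words_rep f (\<lambda>k. k = word_code w) = Some w"
  by (simp add: words_rep_eq_Some_iff)

lemma points_words_rep: "points (words_rep f) = words f"
proof (intro set_eqI iffI)
  show "w \<in> words f" if "w \<in> points (words_rep f)" for w
    using that by (auto simp: ran_def words_rep_eq_Some_iff)
qed (rule ranI, erule words_rep_singleton)

lemma recursive_functional_Least_oracle:
  "recf a \<Longrightarrow> recursive_functional (\<lambda>p n. if \<exists>k. p (a p k) then Some (LEAST k. p (a p k)) else None)"
  by (rule recf_Least_partial) (intro rec_intros, rule recf_comp, assumption, intro rec_intros)

text \<open>The argument is recovered from its name by searching for the first 1; \<open>Q\<close>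
  then acts on the number alone.\<close>

lemma computable_map_natI:
  assumes Q: "recp (\<lambda>p x. Q (pfst x) (psnd x))" and Y: "\<And>n. Y (Q n) = Some (g n)"
  shows "computable_map nat_rep Y g"
  unfolding computable_map_def computable_mv_def
proof (rule exI, intro conjI allI impI)
  let ?F = "\<lambda>p n. Option.bind (if \<exists>k. p k then Some (LEAST k. p k) else None)
      (\<lambda>c. Some (of_bool (Q c n)))"
  show "recursive_functional ?F"
    by (rule recursive_functional_bind_total[OF recursive_functional_Least_oracle[OF recf_id]])
      (intro rec_intros Q)
  fix p x assume "nat_rep p = Some x \<and> {g x} \<noteq> {}"
  then have "\<exists>k. p k" "(LEAST k. p k) = x" by (auto simp: nat_rep_def split: if_splits)
  then have "computes_from ?F p (Q x)" by (simp add: computes_from_def)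
  then show "\<exists>q y. computes_from ?F p q \<and> Y q = Some y \<and> y \<in> {g x}" using Y by blast
qed

lemma computable_map_wordsI:
  assumes Q: "recp (\<lambda>p x. Q (pfst x) (psnd x))"
    and Y: "\<And>w. w \<in> words f \<Longrightarrow> Y (Q (word_code w)) = Some (g w)"
  shows "computable_map (words_rep f) Y g"
  unfolding computable_map_def computable_mv_def
proof (rule exI, intro conjI allI impI)
  let ?F = "\<lambda>p n. Option.bind (if \<exists>k. p k then Some (LEAST k. p k) else None)
      (\<lambda>c. Some (of_bool (Q c n)))"
  show "recursive_functional ?F"
    by (rule recursive_functional_bind_total[OF recursive_functional_Least_oracle[OF recf_id]])
      (intro rec_intros Q)
  fix p w assume "words_rep f p = Some w \<and> {g w} \<noteq> {}"
  then have w: "w \<in> words f" "\<exists>k. p k" "(LEAST k. p k) = word_code w"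
    by (auto simp: words_rep_eq_Some_iff)
  then have "computes_from ?F p (Q (word_code w))" by (simp add: computes_from_def)
  then show "\<exists>q y. computes_from ?F p q \<and> Y q = Some y \<and> y \<in> {g w}" using Y w by blast
qed

text \<open>The two names are interleaved, so one search runs over the even and one over the odd
  positions.\<close>

lemma computable_map_words_pairI:
  assumes Q: "recp (\<lambda>p x. Q (pfst (pfst x)) (psnd (pfst x)) (psnd x))"
    and Y: "\<And>w v. w \<in> words f \<Longrightarrow> v \<in> words f \<Longrightarrow>
      Y (Q (word_code w) (word_code v)) = Some (g (w, v))"
  shows "computable_map (prod_rep (words_rep f) (words_rep f)) Y g"
  unfolding computable_map_def computable_mv_def
proof (rule exI, intro conjI allI impI)
  let ?L = "\<lambda>a p (n::nat). if \<exists>k. p (a k) then Some (LEAST k. p (a k)) else None"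
  let ?P = "\<lambda>p n. Option.bind (?L (\<lambda>k. 2 * k) p n) (\<lambda>a. Option.bind (?L (\<lambda>k. 2 * k + 1) p n)
      (\<lambda>b. Some (prod_encode (a, b))))"
  let ?F = "\<lambda>p n. Option.bind (?P p n) (\<lambda>c. Some (of_bool (Q (pfst c) (psnd c) n)))"
  have "recursive_functional (?L (\<lambda>k. 2 * k))" "recursive_functional (?L (\<lambda>k. 2 * k + 1))"
    by (intro recursive_functional_Least_oracle rec_intros)+
  then have "recursive_functional ?P" by (rule rf_pair)
  then show "recursive_functional ?F"
    by (rule recursive_functional_bind_total)
      (use recp_comp[OF Q, of "\<lambda>p n. n"] in \<open>simp add: recp_def recf_id\<close>)
  fix p x assume x: "prod_rep (words_rep f) (words_rep f) p = Some x \<and> {g x} \<noteq> {}"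
  obtain w v where wv: "x = (w, v)" by fastforce
  with x have "words_rep f (\<lambda>n. p (2 * n)) = Some w" "words_rep f (\<lambda>n. p (2 * n + 1)) = Some v"
    by (auto simp: prod_rep_def bind_eq_Some_conv)
  then have w: "w \<in> words f" "\<exists>k. p (2 * k)" "(LEAST k. p (2 * k)) = word_code w"
    and v: "v \<in> words f" "\<exists>k. p (2 * k + 1)" "(LEAST k. p (2 * k + 1)) = word_code v"
    by (simp_all only: words_rep_eq_Some_iff)
  have "computes_from ?F p (Q (word_code w) (word_code v))"
    unfolding computes_from_def using w v by simp
  then show "\<exists>q y. computes_from ?F p q \<and> Y q = Some y \<and> y \<in> {g x}" using Y w v wv by blast
qed

context compact_dyadic_space
begin

lemma computable_flen: "computable_map nat_rep nat_rep flen"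
  by (rule computable_map_natI[where Q = "\<lambda>n k. k = flen n"])
    (intro rec_intros, rule nat_rep_singleton)

lemma computable_R: "computable_map (words_rep flen) (open_rep X) R"
  by (rule computable_map_wordsI[where Q = "\<lambda>c. assoc_of (R_acc c)"])
    (intro rec_intros, rule accepts_imp_open_rep[OF accepts_R])

lemma R'_subset_points: "R' w \<subseteq> points X"
  by (auto simp: R'_def closed_of_def)

lemma R_subset_R': "R w \<subseteq> R' w"
  using closure_of_subset[OF openin_subset[OF openin_R]] by (simp add: closure_of_R)

lemma computable_R': "computable_map (words_rep flen) (closed_rep X) R'"
proof (rule computable_map_wordsI[where Q = "\<lambda>c. assoc_of (R'_acc c)"])
  show "closed_rep X (assoc_of (R'_acc (word_code w))) = Some (R' w)" for w
    using accepts_imp_open_rep[OF accepts_R'] R'_subset_points[of w]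
    by (auto simp: closed_rep_def)
qed (intro rec_intros)

text \<open>Disjointness is never decided. \<open>None\<close> is returned only if one of the words
  is invalid and its set empty by definition; two valid words have a join even when their sets are
  disjoint.\<close>

lemma computable_intersection:
  "\<exists>I. computable_map (prod_rep (words_rep flen) (words_rep flen)) (option_rep (words_rep flen)) I \<and>
     (\<forall>w \<in> words flen. \<forall>v \<in> words flen.
        case I (w, v) of None \<Rightarrow> R w \<inter> R v = {} | Some u \<Rightarrow> prefix w u \<and> R w \<inter> R v = R u)"
proof -
  \<comment> \<open>As in \<open>option_rep\<close>, bit 0 tells whether there is a value; the
    one-point name of the join follows, shifted by one.\<close>
  let ?Q = "\<lambda>c c' k. if k = 0 then ok c \<and> ok c' else k - 1 = join c c'"
  let ?I = "\<lambda>(w, v). if ok (word_code w) \<and> ok (word_code v)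
      then Some (inv word_code (join (word_code w) (word_code v))) else None"
  have "computable_map (prod_rep (words_rep flen) (words_rep flen)) (option_rep (words_rep flen)) ?I"
  proof (rule computable_map_words_pairI[where Q = ?Q])
    show "recp (\<lambda>p x. ?Q (pfst (pfst x)) (psnd (pfst x)) (psnd x))"
      by (intro rec_intros)
    fix w v
    show "option_rep (words_rep flen) (?Q (word_code w) (word_code v)) = Some (?I (w, v))"
      using words_rep_singleton[of "inv word_code (join (word_code w) (word_code v))" flen]
        join_word[of w v "inv word_code (join (word_code w) (word_code v))"]
      by (auto simp: option_rep_def)
  qed
  moreover have "case ?I (w, v) of None \<Rightarrow> R w \<inter> R v = {} | Some u \<Rightarrow> prefix w u \<and> R w \<inter> R v = R u"
    for w v
    using join_word[of w v] by (auto simp: R_def[of w] R_def[of v])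
  ultimately show ?thesis by blast
qed

text \<open>The words listed are those with \<open>R' w \<subseteq> U\<close>. As this says that
  \<open>U\<close> and the complement of \<open>R' w\<close> cover the space, \<open>F\<close>
  semidecides it; \<open>R_basis\<close> shows that these words exhaust \<open>U\<close>.\<close>

lemma computable_basis_enumeration:
  "computable_mv (open_rep X) (seq_rep (option_rep (words_rep flen)))
     (\<lambda>U. {s. U = (\<Union>i \<in> {i. Some i \<in> range s}. R i)})"
  unfolding computable_mv_def
proof (rule exI, intro conjI allI impI)
  let ?G = "\<lambda>p c. assoc_of (\<lambda>u. acc_of p u \<or> R'_acc c u)"
  \<comment> \<open>The argument \<open>N\<close> codes the sequence index, itself a pair of a word
    code and an output position of \<open>F\<close>, together with a bit position in the entry at
    that index.\<close>
  let ?H = "\<lambda>p N. F (?G p (pfst (pfst N))) (psnd (pfst N))"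
  \<comment> \<open>Only the flag at bit 0 depends on \<open>F\<close>; the later bits may always
    name the word, as \<open>option_rep\<close> ignores them when the flag is off.\<close>
  let ?g = "\<lambda>a N. if psnd N = 0 then a = 1 \<and> flen (level (pfst (pfst N))) = code_len (pfst (pfst N))
      else psnd N - 1 = pfst (pfst N)"
  let ?F = "\<lambda>p N. Option.bind (?H p N) (\<lambda>a. Some (of_bool (?g a N)))"
  have "recp (\<lambda>p x. ?G p (pfst x) (psnd x))" by (intro rec_intros)
  from rf_comp[OF recursive_functional_subst[OF rec_F this] rf_left]
  have "recursive_functional ?H" by simp
  moreover have "recf (\<lambda>p x. of_bool (?g (pfst x) (psnd x)))" by (intro rec_intros)
  ultimately show "recursive_functional ?F" by (rule recursive_functional_bind_total)
  fix p U assume "open_rep X p = Some U \<and> {s. U = (\<Union>i \<in> {i. Some i \<in> range s}. R i)} \<noteq> {}"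
  then have acc: "accepts X (acc_of p) U" using open_rep_imp_accepts by blast
  define V where "V c s \<longleftrightarrow> F (?G p c) s = Some 1" for c s
  have V: "F (?G p c) s = Some (of_bool (V c s))" "(\<exists>s. V c s) \<longleftrightarrow> R' (inv word_code c) \<subseteq> U" for c s
  proof -
    have "accepts X (R'_acc c) (points X - R' (inv word_code c))"
      using accepts_R'[of "inv word_code c"] by simp
    from F[OF accepts_disj[OF acc this]] obtain q where
      q: "computes_from F (?G p c) q" "(\<exists>s. q s) \<longleftrightarrow> U \<union> (points X - R' (inv word_code c)) = points X"
      by blast
    have Vq: "V c s = q s" for s using q(1) by (simp add: V_def computes_from_def)
    show "F (?G p c) s = Some (of_bool (V c s))" using q(1) Vq by (simp add: computes_from_def)
    have "U \<subseteq> points X" using acc by (simp add: accepts_def)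
    then show "(\<exists>s. V c s) \<longleftrightarrow> R' (inv word_code c) \<subseteq> U"
      using Vq q(2) R'_subset_points[of "inv word_code c"] by auto
  qed
  let ?in = "\<lambda>c. flen (level c) = code_len c"
  let ?q = "\<lambda>N. if psnd N = 0 then V (pfst (pfst N)) (psnd (pfst N)) \<and> ?in (pfst (pfst N))
      else psnd N - 1 = pfst (pfst N)"
  let ?s = "\<lambda>n. if V (pfst n) (psnd n) \<and> ?in (pfst n) then Some (inv word_code (pfst n)) else None"
  have "computes_from ?F p ?q"
    unfolding computes_from_def by (simp add: V(1))
  moreover have "seq_rep (option_rep (words_rep flen)) ?q = Some ?s"
  proof -
    have "option_rep (words_rep flen) (\<lambda>k. ?q (prod_encode (n, k))) = Some (?s n)" for n
      using words_rep_singleton[of "inv word_code (pfst n)" flen] mem_words_flen_iff[of "inv word_code (pfst n)"]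
      by (auto simp: option_rep_def)
    then show ?thesis unfolding seq_rep_def by simp
  qed
  moreover have "?s \<in> {s. U = (\<Union>i \<in> {i. Some i \<in> range s}. R i)}"
  proof -
    have "Some w \<in> range ?s \<longleftrightarrow> w \<in> words flen \<and> R' w \<subseteq> U" for w
    proof
      assume "Some w \<in> range ?s"
      then obtain n where "V (pfst n) (psnd n)" "?in (pfst n)" "w = inv word_code (pfst n)"
        by (auto split: if_splits)
      then show "w \<in> words flen \<and> R' w \<subseteq> U"
        using V(2)[of "pfst n"] mem_words_flen_iff[of "inv word_code (pfst n)"] by fastforce
    next
      assume w: "w \<in> words flen \<and> R' w \<subseteq> U"
      then obtain s where "V (word_code w) s" using V(2)[of "word_code w"] by auto
      then have "?s (prod_encode (word_code w, s)) = Some w" using w mem_words_flen_iff by simp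
      then show "Some w \<in> range ?s" by (intro range_eqI) (rule sym)
    qed
    then have "{i. Some i \<in> range ?s} = {w \<in> words flen. R' w \<subseteq> U}" by blast
    moreover have "U = (\<Union>w\<in>{w \<in> words flen. R' w \<subseteq> U}. R w)"
    proof (intro set_eqI iffI)
      fix x assume "x \<in> U"
      from R_basis[OF accepts_imp_openin[OF acc] this]
      show "x \<in> (\<Union>w\<in>{w \<in> words flen. R' w \<subseteq> U}. R w)" by blast
    qed (use R_subset_R' in blast)
    ultimately show ?thesis by simp
  qed
  ultimately show "\<exists>q y. computes_from ?F p q \<and> seq_rep (option_rep (words_rep flen)) q = Some y \<and>
      y \<in> {s. U = (\<Union>i \<in> {i. Some i \<in> range s}. R i)}" by blast
qed

lemma effective_countable_basis_R: "effective_countable_basis (words_rep flen) X R"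
  unfolding effective_countable_basis_def points_words_rep
proof (intro conjI ballI allI impI)
  show "\<exists>J\<subseteq>words flen. U = \<Union> (R ` J)" if "openin (rep_topology X) U" for U
    using R_basis[OF that] R_subset_R'
    by (intro exI[of _ "{w \<in> words flen. R' w \<subseteq> U}"]) blast
qed (simp_all add: openin_R computable_R computable_basis_enumeration)

end

section \<open>From the hypotheses to the locale\<close>

theorem theorem19:
  fixes X :: "'a repspace" and S :: "nat \<times> bool \<Rightarrow> 'a set"
  assumes "computably_compact X"
    and "Hausdorff_space (rep_topology X)"
    and "computable_dyadic_subbase X S"
    and "proper_subbase X S"
  shows "\<exists>(f :: nat \<Rightarrow> nat) (R :: bool list \<Rightarrow> 'a set) (R' :: bool list \<Rightarrow> 'a set).
    computable_map nat_rep nat_rep f \<and> strict_mono f \<and> f 0 = 0 \<and>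
    computable_map (words_rep f) (open_rep X) R \<and>
    computable_map (words_rep f) (closed_rep X) R' \<and>
    R [] = points X \<and>
    (\<forall>n. \<forall>w \<in> words_of_length (f n).
       R w = (\<Union>v \<in> {v \<in> words_of_length (f (n + 1)). prefix w v}. R v)) \<and>
    (\<forall>w \<in> words f. rep_topology X closure_of R w = R' w) \<and>
    effective_countable_basis (words_rep f) X R \<and>
    (\<exists>I :: bool list \<times> bool list \<Rightarrow> bool list option.
       computable_map (prod_rep (words_rep f) (words_rep f)) (option_rep (words_rep f)) I \<and>
       (\<forall>w \<in> words f. \<forall>v \<in> words f.
          case I (w, v) of
            None \<Rightarrow> R w \<inter> R v = {}
          | Some u \<Rightarrow> prefix w u \<and> R w \<inter> R v = R u)) \<and>
    (\<exists>E :: bool list \<times> bool list \<Rightarrow> bool.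
       computable_map (prod_rep (words_rep f) (words_rep f)) bool_rep E \<and>
       (\<forall>w \<in> words f. \<forall>v \<in> words f. E (w, v) \<longrightarrow> R w = R v) \<and>
       (\<forall>x \<in> points X. \<forall>y \<in> points X. x \<noteq> y \<longrightarrow>
          (\<exists>n. \<forall>w \<in> words_of_length (f n). \<forall>v \<in> words_of_length (f n).
             x \<in> R' w \<and> y \<in> R' w \<and> x \<in> R' v \<and> y \<in> R' v \<longrightarrow> E (w, v))))"
proof -
  obtain F where rec_F: "recursive_functional F" and F: "\<forall>p C. closed_rep X p = Some C \<and> {C = {}} \<noteq> {} \<longrightarrow>
      (\<exists>q y. computes_from F p q \<and> sierp_rep q = Some y \<and> y \<in> {C = {}})"
    using assms(1) unfolding computably_compact_def computable_map_def computable_mv_def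
    by (elim exE conjE)
  have dyadic: "dyadic_subbase X S"
    using assms(3) by (simp add: computable_dyadic_subbase_def)
  obtain H where rec_H: "recursive_functional H" and
    H: "\<forall>p x. prod_rep nat_rep bool_rep p = Some x \<and> {S x} \<noteq> {} \<longrightarrow>
      (\<exists>q y. computes_from H p q \<and> open_rep X q = Some y \<and> y \<in> {S x})"
    using assms(3)
    unfolding computable_dyadic_subbase_def computable_map_def computable_mv_def
    by (elim exE conjE)
  \<comment> \<open>The even positions name the index \<open>l div 2\<close> by a one-point
    sequence; the odd positions constantly carry the sign.\<close>
  define name :: "nat \<Rightarrow> cantor" where
    "name l = (\<lambda>N. if even N then N div 2 = l div 2 else odd l)" for l
  have name: "prod_rep nat_rep bool_rep (name l) = Some (l div 2, odd l)" for l
    using nat_rep_singleton[of "l div 2"] by (simp add: prod_rep_def name_def bool_rep_def)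
  \<comment> \<open>Running \<open>H\<close> on one fixed name per literal selects a single open-set
    name for it, uniformly recursive in \<open>l\<close>.\<close>
  define s where "s l k \<longleftrightarrow> H (name l) k = Some 1" for l k
  have s: "H (name l) k = Some (of_bool (s l k))" "open_rep X (s l) = Some (S (l div 2, odd l))" for l k
  proof -
    obtain q where q: "computes_from H (name l) q" "open_rep X q = Some (S (l div 2, odd l))"
      using H[rule_format, OF conjI[OF name]] by auto
    have "s l = q" using q(1) by (auto simp: s_def computes_from_def fun_eq_iff)
    then show "H (name l) k = Some (of_bool (s l k))" "open_rep X (s l) = Some (S (l div 2, odd l))"
      using q by (simp_all add: computes_from_def)
  qed
  have "recp (\<lambda>p x. name (pfst x) (psnd x))"
    unfolding name_def by (intro rec_intros)
  from recursive_functional_subst[OF rec_H this]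
  have rec_s: "recp (\<lambda>p x. s (pfst x) (psnd x))" by (simp add: recp_def recf_def s(1))
  interpret compact_dyadic_space X S "\<lambda>l. acc_of (s l)" F
  proof
    show "recp (\<lambda>p n. acc_of (s (pfst n)) (psnd n))"
      by (intro rec_intros recp_comp2[OF rec_s])
    show "rep_topology X = topology_generated_by (insert (points X) (range S))"
      "S (n, False) \<inter> S (n, True) = {}" for n
      using dyadic by (simp_all add: dyadic_subbase_def)
    show "accepts X (acc_of (s l)) (S (l div 2, odd l))" for l
      by (rule open_rep_imp_accepts[OF s(2)])
    show "\<exists>q. computes_from F (assoc_of B) q \<and> (\<exists>s. q s) = (U = points X)"
      if "accepts X B U" for B U
    proof -
      have "closed_rep X (assoc_of B) = Some (points X - U)"
        by (simp add: closed_rep_def accepts_imp_open_rep[OF that])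
      from F[rule_format, OF conjI[OF this]] obtain q
        where "computes_from F (assoc_of B) q" "(\<exists>s. q s) = (points X - U = {})"
        by (auto simp: sierp_rep_def)
      then show ?thesis using that by (auto simp: accepts_def)
    qed
  qed (use assms rec_F mono_acc_of in auto)
  let ?E = "\<lambda>_ :: bool list \<times> bool list. False"
  have "computable_map (prod_rep (words_rep flen) (words_rep flen)) bool_rep ?E"
    by (rule computable_map_words_pairI[where Q = "\<lambda>_ _ _. False"])
      (simp_all add: recp_def recf_const bool_rep_def)
  moreover have "\<exists>n. \<forall>w \<in> words_of_length (flen n). \<forall>v \<in> words_of_length (flen n).
      x \<in> R' w \<and> y \<in> R' w \<and> x \<in> R' v \<and> y \<in> R' v \<longrightarrow> ?E (w, v)" if "x \<noteq> y" for x y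
    using R'_separates[OF that] by blast
  ultimately show ?thesis
    using computable_flen strict_mono_flen computable_R computable_R' R_Nil R_Union closure_of_R
      effective_countable_basis_R computable_intersection
    by (intro exI[of _ flen] exI[of _ R] exI[of _ R'] conjI exI[of _ ?E]) auto
qed

end
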